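(* Let $\phi$ and $E$ be entire functions such that $E$ belongs to the Hermite-Biehler class $\mathcal{H}B$. If the composition operator $C_\phi$, $C_\phi f=f\circ\phi$, is bounded on $H(E)$, then $$\sup_{z\in\Lambda}\ \frac{\Im(z)}{\Im(\phi(z))}\left|\frac{E\circ\phi(z)}{E(z)}\right|^2\left(\frac{1-|\chi(\phi(z))|^2}{1-|\chi(z)|^2}\right)<\infty ,$$ where $\chi=\frac{E^{\#}}{E}$ and $\Lambda=\{z\in\mathbb{C}_+: E(\phi(z))\neq 0\}$. Moreover, if the entire function $\phi$ is such that $\phi(\mathbb{C}_+)\subseteq\mathbb{C}_+$, then $\Lambda=\mathbb{C}_+$.
   Context: $\mathbb{C}_+$ is the open upper half-plane and $\Im(z)$ is the imaginary part of $z$; for an entire function $f$, $f^{\#}(z):=\overline{f(\bar z)}$. $H^2(\mathbb{C}_+)$ is the Hardy Hilbert space on $\mathbb{C}_+$. An entire function $E$ is in the Hermite-Biehler class $\mathcal{H}B$ if $|E(\bar z)|<|E(z)|$ for all $z\in\mathbb{C}_+$. For $E\in\mathcal{H}B$ the de Branges space is $$H(E):=\left\{f \text{ entire}: \tfrac{f}{E},\ \tfrac{f^{\#}}{E}\in H^2(\mathbb{C}_+)\right\},\qquad \langle f,g\rangle_{H(E)}=\int_{-\infty}^{\infty}\frac{f(t)\overline{g(t)}}{|E(t)|^2}\,dt .$$ For $z\in\Lambda$, $\chi(\phi(z))=E^{\#}(\phi(z))/E(\phi(z))$. Saying that $C_\phi$ is bounded on $H(E)$ means that $f\circ\phi\in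 H(E)$ for every $f\in H(E)$ and $f\mapsto f\circ\phi$ is a bounded linear operator on $H(E)$. *)

theory Defs
  imports "HOL-Complex_Analysis.Complex_Analysis"
begin

definition upper_half_plane :: "complex set" where
  "upper_half_plane = {z. Im z > 0}"

definition entire :: "(complex \<Rightarrow> complex) \<Rightarrow> bool" where
  "entire f \<longleftrightarrow> f holomorphic_on UNIV"

definition sharp :: "(complex \<Rightarrow> complex) \<Rightarrow> complex \<Rightarrow> complex" where
  "sharp f z = cnj (f (cnj z))"

text \<open>The Hardy space $H^2$ of the upper half-plane: the square integrals over the horizontal
  lines are bounded uniformly in the height. Values outside the half-plane are irrelevant.\<close>

definition hardy_H2 :: "(complex \<Rightarrow> complex) set" where
  "hardy_H2 = {f. f holomorphic_on upper_half_plane \<and>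
     (SUP y\<in>{0<..}. \<integral>\<^sup>+x. ennreal ((cmod (f (Complex x y)))\<^sup>2) \<partial>lborel) < \<infinity>}"

definition hermite_biehler :: "(complex \<Rightarrow> complex) \<Rightarrow> bool" where
  "hermite_biehler E \<longleftrightarrow>
     entire E \<and> (\<forall>z\<in>upper_half_plane. cmod (E (cnj z)) < cmod (E z))"

definition de_branges :: "(complex \<Rightarrow> complex) \<Rightarrow> (complex \<Rightarrow> complex) set" where
  "de_branges E = {f. entire f \<and> (\<lambda>z. f z / E z) \<in> hardy_H2
                               \<and> (\<lambda>z. sharp f z / E z) \<in> hardy_H2}"

text \<open>\<^term>\<open>E\<close> may vanish at real points; these form a null set, so the value that division
  by zero gives to the integrand there does not matter.\<close>

definition db_inner ::
  "(complex \<Rightarrow> complex) \<Rightarrow> (complex \<Rightarrow> complex) \<Rightarrow> (complex \<Rightarrow> complex) \<Rightarrow> complex" where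
  "db_inner E f g =
     (\<integral>t. f (of_real t) * cnj (g (of_real t)) / of_real ((cmod (E (of_real t)))\<^sup>2) \<partial>lborel)"

definition db_norm :: "(complex \<Rightarrow> complex) \<Rightarrow> (complex \<Rightarrow> complex) \<Rightarrow> real" where
  "db_norm E f = sqrt (Re (db_inner E f f))"

definition bounded_operator_on ::
  "(complex \<Rightarrow> complex) \<Rightarrow> ((complex \<Rightarrow> complex) \<Rightarrow> (complex \<Rightarrow> complex)) \<Rightarrow> bool" where
  "bounded_operator_on E T \<longleftrightarrow>
     (\<forall>f\<in>de_branges E. T f \<in> de_branges E) \<and>
     (\<forall>f\<in>de_branges E. \<forall>g\<in>de_branges E. T (\<lambda>z. f z + g z) = (\<lambda>z. T f z + T g z)) \<and>
     (\<forall>c. \<forall>f\<in>de_branges E. T (\<lambda>z. c * f z) = (\<lambda>z. c * T f z)) \<and>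
     (\<exists>C. \<forall>f\<in>de_branges E. db_norm E (T f) \<le> C * db_norm E f)"

definition comp_op :: "(complex \<Rightarrow> complex) \<Rightarrow> (complex \<Rightarrow> complex) \<Rightarrow> complex \<Rightarrow> complex" where
  "comp_op \<phi> f = f \<circ> \<phi>"

definition chi :: "(complex \<Rightarrow> complex) \<Rightarrow> complex \<Rightarrow> complex" where
  "chi E z = sharp E z / E z"

definition Lam :: "(complex \<Rightarrow> complex) \<Rightarrow> (complex \<Rightarrow> complex) \<Rightarrow> complex set" where
  "Lam E \<phi> = {z \<in> upper_half_plane. E (\<phi> z) \<noteq> 0}"

definition quotient_expr :: "(complex \<Rightarrow> complex) \<Rightarrow> complex \<Rightarrow> complex \<Rightarrow> real" where
  "quotient_expr E z w =
     Im z / Im w * (cmod (E w / E z))\<^sup>2 * ((1 - (cmod (chi E w))\<^sup>2) / (1 - (cmod (chi E z))\<^sup>2))"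

text \<open>In \<^term>\<open>comp_quotient E \<phi> z\<close> the point \<^term>\<open>w = \<phi> z\<close> may be real. Then
  \<open>\<bar>chi E w\<bar> = 1\<close> and the formula reads 0/0. Up to a factor depending only on \<^term>\<open>z\<close> it is
  \<open>(\<bar>E w\<bar>\<^sup>2 - \<bar>E (cnj w)\<bar>\<^sup>2) / Im w\<close>, a multiple of the diagonal of the reproducing kernel,
  which extends continuously to real \<^term>\<open>w\<close>; we use this limit rather than the value 0 that
  division by zero would give. The limit is taken in the point \<^term>\<open>w\<close>, not in \<^term>\<open>z\<close>,
  so that it also makes sense for constant \<^term>\<open>\<phi>\<close>.\<close>

definition comp_quotient ::
  "(complex \<Rightarrow> complex) \<Rightarrow> (complex \<Rightarrow> complex) \<Rightarrow> complex \<Rightarrow> real" where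
  "comp_quotient E \<phi> z =
     (if Im (\<phi> z) \<noteq> 0 then quotient_expr E z (\<phi> z)
      else Lim (at (\<phi> z) within {w. Im w \<noteq> 0}) (quotient_expr E z))"

end

theory Submission
  imports Defs "HOL-Probability.Sinc_Integral"
begin

text \<open>
  Let \<open>K\<^sub>w\<close> be the reproducing kernel of \<open>H(E)\<close>. When \<open>w\<close> is not real,
  \<open>4 \<pi> K\<^sub>w(w) = (\<bar>E w\<bar>\<^sup>2 - \<bar>E (cnj w)\<bar>\<^sup>2) / Im w\<close>, and factoring \<open>\<bar>E\<bar>\<^sup>2\<close> out of this
  expression shows that the quotient in the theorem is \<open>K\<^sub>w(w) / K\<^sub>z(z)\<close> with \<open>w = \<phi> z\<close>. So
  the claim is the usual test of a composition operator on kernel functions. The function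
  \<open>f = K\<^sub>w\<close> satisfies \<open>f (\<phi> z) = K\<^sub>w(w) = \<parallel>f\<parallel>\<^sup>2\<close>, and evaluation of \<open>f \<circ> \<phi>\<close> at \<open>z\<close> gives
  \<open>\<bar>f (\<phi> z)\<bar>\<^sup>2 \<le> \<parallel>f \<circ> \<phi>\<parallel>\<^sup>2 K\<^sub>z(z) \<le> C\<^sup>2 \<parallel>f\<parallel>\<^sup>2 K\<^sub>z(z)\<close>; hence \<open>K\<^sub>w(w) / K\<^sub>z(z) \<le> C\<^sup>2\<close>
  (\<open>comp_quotient_bound\<close>).

  The work lies in the two facts about kernels: \<open>K\<^sub>w\<close> belongs to \<open>H(E)\<close> (\<open>kernel_mem\<close>), which
  follows from its decay like \<open>1 / z\<close> relative to \<open>E\<close>, and it reproduces (\<open>reproducing\<close>). The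
  latter is two applications of Cauchy's formula on the real line: \<open>f / E\<close> recovers its value at
  \<open>w\<close> from its boundary values, while \<open>f\<^sup># / E\<close> integrates to \<open>0\<close> against the Cauchy kernel of
  a point of the lower half-plane. The boundary values
  are ordinary values here: \<open>f\<close> and \<open>E\<close> are entire, and a pole of \<open>f / E\<close> at a real zero of \<open>E\<close> would make the integrals over
  horizontal lines blow up (\<open>hardy_H2_no_real_pole\<close>), so \<open>f / E\<close> is analytic up to and across
  the real line, and Cauchy's formula is taken on rectangles whose bottom side lies on it.

  When \<open>w = \<phi> z\<close> is real, the quotient is defined as a limit over nonreal points. The test
  functions are then \<open>K\<^sub>v\<close> for nonreal \<open>v\<close> tending to \<open>w\<close>, evaluated at \<open>w\<close>; both
  \<open>K\<^sub>v(v)\<close> and \<open>K\<^sub>v(w)\<close> converge to the same number. Approximating the parameter \<open>v\<close> rather than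
  the point \<open>z\<close> also covers constant \<open>\<phi>\<close>.
\<close>

section \<open>Horizontal lines and the Hardy space\<close>

lemma poisson_kernel:
  fixes u d :: real
  assumes "d > 0"
  shows "integrable lborel (\<lambda>x. 1 / ((x - u)\<^sup>2 + d\<^sup>2))" 
    and "(LINT x|lborel. 1 / ((x - u)\<^sup>2 + d\<^sup>2)) = pi / d"
proof -
  have int: "integrable lborel (\<lambda>x::real. inverse (1 + x\<^sup>2))"
    using integrable_inverse_1_plus_square by (simp add: set_integrable_def)
  have val: "(LINT x|lborel. inverse (1 + x\<^sup>2 :: real)) = pi"
    using LBINT_inverse_1_plus_square
    by (simp add: interval_lebesgue_integral_def set_lebesgue_integral_def)
  have eq: "(\<lambda>x. 1 / ((x - u)\<^sup>2 + d\<^sup>2)) = (\<lambda>x. inverse (1 + (- u / d + 1 / d * x)\<^sup>2) / d\<^sup>2)"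
  proof
    fix x
    have "1 + (- u / d + 1 / d * x)\<^sup>2 = ((x - u)\<^sup>2 + d\<^sup>2) / d\<^sup>2"
      using assms by (simp add: field_simps power2_eq_square)
    then show "1 / ((x - u)\<^sup>2 + d\<^sup>2) = inverse (1 + (- u / d + 1 / d * x)\<^sup>2) / d\<^sup>2"
      using assms by (simp only:) simp
  qed
  show "integrable lborel (\<lambda>x. 1 / ((x - u)\<^sup>2 + d\<^sup>2))"
    unfolding eq using assms by (intro integrable_divide lborel_integrable_real_affine int) auto
  have "pi = \<bar>1 / d\<bar> *\<^sub>R (LINT x|lborel. inverse (1 + (- u / d + 1 / d * x)\<^sup>2))"
    using assms val by (subst lborel_integral_real_affine[of "1 / d" _ "- u / d", symmetric]) auto
  then have "(LINT x|lborel. inverse (1 + (- u / d + 1 / d * x)\<^sup>2)) = pi * d"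
    using assms by (simp add: divide_simps mult_ac)
  then show "(LINT x|lborel. 1 / ((x - u)\<^sup>2 + d\<^sup>2)) = pi / d"
    unfolding eq using assms by (simp only: integral_divide_zero) (simp add: power2_eq_square)
qed

lemma hardy_H2_bound:
  assumes "f \<in> hardy_H2"
  obtains M where "M \<ge> 0"
    "\<And>y. y > 0 \<Longrightarrow> (\<integral>\<^sup>+x. ennreal ((cmod (f (Complex x y)))\<^sup>2) \<partial>lborel) \<le> ennreal M"
proof -
  let ?S = "SUP y\<in>{0<..}. \<integral>\<^sup>+x. ennreal ((cmod (f (Complex x y)))\<^sup>2) \<partial>lborel"
  have "?S < \<infinity>"
    using assms by (simp add: hardy_H2_def)
  then have S: "?S = ennreal (enn2real ?S)"
    by simp
  show thesis
    by (rule that[of "enn2real ?S"], simp, subst S[symmetric], rule SUP_upper) simp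
qed

lemma hardy_H2_I:
  assumes "f holomorphic_on upper_half_plane"
    and "\<And>y. y > 0 \<Longrightarrow> (\<integral>\<^sup>+x. ennreal ((cmod (f (Complex x y)))\<^sup>2) \<partial>lborel) \<le> ennreal M"
  shows "f \<in> hardy_H2"
proof -
  have "(SUP y\<in>{0<..}. \<integral>\<^sup>+x. ennreal ((cmod (f (Complex x y)))\<^sup>2) \<partial>lborel) \<le> ennreal M"
    using assms(2) by (intro SUP_least) auto
  then have "(SUP y\<in>{0<..}. \<integral>\<^sup>+x. ennreal ((cmod (f (Complex x y)))\<^sup>2) \<partial>lborel) < \<infinity>"
    by (rule le_less_trans) simp
  then show ?thesis
    using assms(1) by (simp add: hardy_H2_def)
qed

text \<open>Functions of Hardy class that are analytic across the real line, so that their boundary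
  values are ordinary values.\<close>

locale H2_closed_half_plane =
  fixes h :: "complex \<Rightarrow> complex" and M :: real
  assumes analytic: "h analytic_on {z. Im z \<ge> 0}"
    and M_nonneg: "M \<ge> 0"
    and line_bound: "\<And>y. y > 0 \<Longrightarrow>
          (\<integral>\<^sup>+x. ennreal ((cmod (h (Complex x y)))\<^sup>2) \<partial>lborel) \<le> ennreal M"
begin

lemma holo: "h holomorphic_on {z. Im z \<ge> 0}"
  using analytic by (rule analytic_imp_holomorphic)

lemma cont: "continuous_on {z. Im z \<ge> 0} h"
  using holo by (rule holomorphic_on_imp_continuous_on)

lemma line_continuous: "y \<ge> 0 \<Longrightarrow> continuous_on UNIV (\<lambda>x. h (Complex x y))"
  by (rule continuous_on_compose2[OF cont]) (auto intro!: continuous_intros)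

lemma line_measurable [measurable]: "y \<ge> 0 \<Longrightarrow> (\<lambda>x. h (Complex x y)) \<in> borel_measurable borel"
  by (intro borel_measurable_continuous_onI line_continuous)

text \<open>Fatou's lemma carries the uniform bound down to the real line.\<close>

lemma boundary_bound:
  "(\<integral>\<^sup>+x. ennreal ((cmod (h (Complex x 0)))\<^sup>2) \<partial>lborel) \<le> ennreal M"
proof -
  let ?y = "\<lambda>n. inverse (real (Suc n))"
  have lim: "(\<lambda>n. ennreal ((cmod (h (Complex x (?y n))))\<^sup>2))
               \<longlonglongrightarrow> ennreal ((cmod (h (Complex x 0)))\<^sup>2)" for x
  proof -
    have "continuous_on {0..} (\<lambda>y. h (Complex x y))"
      by (rule continuous_on_compose2[OF cont]) (auto intro!: continuous_intros)
    from continuous_on_tendsto_compose[OF this LIMSEQ_inverse_real_of_nat]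
    have "(\<lambda>n. h (Complex x (?y n))) \<longlonglongrightarrow> h (Complex x 0)"
      by auto
    then show ?thesis
      by (intro tendsto_ennrealI tendsto_intros)
  qed
  have "(\<integral>\<^sup>+x. ennreal ((cmod (h (Complex x 0)))\<^sup>2) \<partial>lborel)
        = (\<integral>\<^sup>+x. liminf (\<lambda>n. ennreal ((cmod (h (Complex x (?y n))))\<^sup>2)) \<partial>lborel)"
    using lim_imp_Liminf[OF sequentially_bot lim] by simp
  also have "\<dots> \<le> liminf (\<lambda>n. \<integral>\<^sup>+x. ennreal ((cmod (h (Complex x (?y n))))\<^sup>2) \<partial>lborel)"
    by (intro nn_integral_liminf) simp
  also have "\<dots> \<le> limsup (\<lambda>n. \<integral>\<^sup>+x. ennreal ((cmod (h (Complex x (?y n))))\<^sup>2) \<partial>lborel)"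
    by (rule Liminf_le_Limsup) simp
  also have "\<dots> \<le> ennreal M"
    by (rule Limsup_bounded, rule always_eventually) (intro allI line_bound, simp)
  finally show ?thesis .
qed

lemma line_bound_closed: "y \<ge> 0 \<Longrightarrow>
    (\<integral>\<^sup>+x. ennreal ((cmod (h (Complex x y)))\<^sup>2) \<partial>lborel) \<le> ennreal M"
  using line_bound[of y] boundary_bound by (cases "y = 0") auto

lemma line_integrable: "y \<ge> 0 \<Longrightarrow> integrable lborel (\<lambda>x. (cmod (h (Complex x y)))\<^sup>2)"
  using line_bound_closed[of y] by (intro integrableI_bounded) (auto simp: le_less_trans)

lemma line_integral_le:
  assumes "y \<ge> 0"
  shows "(LINT x|lborel. (cmod (h (Complex x y)))\<^sup>2) \<le> M"
proof -
  have "ennreal (LINT x|lborel. (cmod (h (Complex x y)))\<^sup>2) \<le> ennreal M"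
    using line_bound_closed[OF assms] nn_integral_eq_integral[OF line_integrable[OF assms]] by simp
  then show ?thesis using M_nonneg by simp
qed

text \<open>The square of \<open>h\<close> is integrable over the whole strip of height \<open>Y\<close>, so its integrals over
  vertical segments cannot all be large. This replaces pointwise decay of \<open>h\<close>, and the same \<open>R\<close>
  serves for both sides of a rectangle.\<close>

lemma vertical_sides_small:
  assumes "Y > 0" "n \<ge> 0"
  obtains R where "R \<ge> n"
    "(\<integral>\<^sup>+s. indicator {0..Y} s * ennreal ((cmod (h (Complex R s)))\<^sup>2) \<partial>lborel) \<le> 1"
    "(\<integral>\<^sup>+s. indicator {0..Y} s * ennreal ((cmod (h (Complex (-R) s)))\<^sup>2) \<partial>lborel) \<le> 1"
proof -
  define f where "f = (\<lambda>x s. indicator {0..Y} s * ennreal ((cmod (h (Complex x s)))\<^sup>2))"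
  define A where "A = (\<lambda>x. \<integral>\<^sup>+s. f x s \<partial>lborel)"
  have "continuous_on (UNIV \<times> {0..Y}) (\<lambda>p. (cmod (h (Complex (fst p) (snd p))))\<^sup>2)"
    by (intro continuous_intros continuous_on_compose2[OF cont]) auto
  then have "(\<lambda>p. indicator (UNIV \<times> {0..Y}) p *\<^sub>R (cmod (h (Complex (fst p) (snd p))))\<^sup>2)
               \<in> borel_measurable borel"
    by (intro borel_measurable_continuous_on_indicator) 
      (auto intro!: borel_closed closed_Times)
  then have "(\<lambda>p. ennreal (indicator (UNIV \<times> {0..Y}) p *\<^sub>R (cmod (h (Complex (fst p) (snd p))))\<^sup>2))
               \<in> borel_measurable borel"
    by measurable
  also have "(\<lambda>p. ennreal (indicator (UNIV \<times> {0..Y}) p *\<^sub>R (cmod (h (Complex (fst p) (snd p))))\<^sup>2))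
      = case_prod f"
    by (auto simp: f_def fun_eq_iff indicator_def)
  finally have meas [measurable]: "case_prod f \<in> borel_measurable (lborel \<Otimes>\<^sub>M lborel)"
    unfolding lborel_prod by simp
  have Am [measurable]: "A \<in> borel_measurable lborel"
    unfolding A_def by measurable
  have "(\<integral>\<^sup>+x. A x \<partial>lborel) = (\<integral>\<^sup>+s. \<integral>\<^sup>+x. f x s \<partial>lborel \<partial>lborel)"
    unfolding A_def by (rule lborel_pair.Fubini'[symmetric]) (fact meas)
  also have "\<dots> \<le> (\<integral>\<^sup>+s. ennreal M * indicator {0..Y} s \<partial>lborel)"
  proof (intro nn_integral_mono)
    fix s
    show "(\<integral>\<^sup>+x. f x s \<partial>lborel) \<le> ennreal M * indicator {0..Y} s"
      using line_bound_closed[of s] by (auto simp: f_def indicator_def)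
  qed
  also have "\<dots> = ennreal M * ennreal Y"
    using \<open>Y > 0\<close> by (simp add: nn_integral_cmult_indicator)
  also have "\<dots> < \<infinity>"
    by (simp add: ennreal_mult_less_top)
  finally have fin: "(\<integral>\<^sup>+x. A x \<partial>lborel) < \<infinity>" .
  have "(\<integral>\<^sup>+x. A x \<partial>lborel) = (\<integral>\<^sup>+x. A (- x) \<partial>lborel)"
    using nn_integral_real_affine[of A "-1" 0] by simp
  with fin have fin2: "(\<integral>\<^sup>+x. A x + A (- x) \<partial>lborel) < \<infinity>"
    by (subst nn_integral_add) auto
  have "\<exists>R\<ge>n. A R + A (- R) \<le> 1"
  proof (rule ccontr)
    assume "\<not> ?thesis"
    then have "1 \<le> A x + A (- x)" if "n \<le> x" for x
      using that by (meson le_cases not_le)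
    then have "indicator {n..} x \<le> A x + A (- x)" for x
      by (simp add: indicator_def)
    then have "(\<integral>\<^sup>+x. indicator {n..} x \<partial>lborel) \<le> (\<integral>\<^sup>+x. A x + A (- x) \<partial>lborel)"
      by (intro nn_integral_mono)
    also have "\<dots> < \<infinity>" by (fact fin2)
    finally have "emeasure lborel {n..} < \<infinity>" by simp
    then obtain r where r: "r \<ge> 0" "emeasure lborel {n..} = ennreal r"
      by (cases "emeasure lborel {n..}") auto
    have "emeasure lborel {n..n + (r + 1)} \<le> emeasure lborel {n..}"
      by (intro emeasure_mono) auto
    with r show False by (simp add: ennreal_le_iff del: ennreal_plus)
  qed
  then obtain R where "R \<ge> n" "A R + A (- R) \<le> 1" by blast
  moreover have "A R \<le> A R + A (- R)" "A (- R) \<le> A R + A (- R)" by auto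
  ultimately show thesis
    using that[of R] unfolding A_def f_def by (meson order_trans)
qed

end

section \<open>Cauchy's formula on the real line\<close>

lemma contour_integral_linepath_horizontal:
  assumes "a < b"
  shows "contour_integral (linepath (Complex a y) (Complex b y)) f
           = integral {a..b} (\<lambda>x. f (Complex x y))"
proof -
  have "contour_integral (linepath (Complex a y) (Complex b y)) f
      = contour_integral (linepath (of_real a) (of_real b)) (\<lambda>z. f (z + Complex 0 y))"
    unfolding contour_integral_integral
    by (simp add: linepath_def Complex_eq scaleR_conv_of_real algebra_simps)
  also have "\<dots> = integral {a..b} (\<lambda>x. f (Complex x y))"
    using assms by (subst contour_integral_linepath_Reals_eq) (auto simp: Complex_eq add.commute)
  finally show ?thesis .
qed

lemma contour_integral_rectpath_sides:
  assumes "R > 0" "Y > 0"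
    and q: "continuous_on (path_image (rectpath (Complex (-R) 0) (Complex R Y))) q"
  shows "contour_integral (rectpath (Complex (-R) 0) (Complex R Y)) q =
      integral {-R..R} (\<lambda>x. q (Complex x 0)) + \<i> * integral {0..Y} (\<lambda>s. q (Complex R s))
      - integral {-R..R} (\<lambda>x. q (Complex x Y)) - \<i> * integral {0..Y} (\<lambda>s. q (Complex (-R) s))"
proof -
  let ?a = "Complex (-R) 0" and ?b = "Complex R 0" and ?c = "Complex R Y" and ?d = "Complex (-R) Y"
  have img: "path_image (rectpath ?a ?c) = closed_segment ?a ?b \<union> closed_segment ?b ?c
       \<union> closed_segment ?c ?d \<union> closed_segment ?d ?a"
    by (simp add: rectpath_def Let_def path_image_join Un_assoc)
  have int: "q contour_integrable_on linepath ?a ?b" "q contour_integrable_on linepath ?b ?c"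
            "q contour_integrable_on linepath ?c ?d" "q contour_integrable_on linepath ?d ?a"
    using q unfolding img
    by (auto intro!: contour_integrable_continuous_linepath elim: continuous_on_subset)
  have "contour_integral (rectpath ?a ?c) q = contour_integral (linepath ?a ?b) q
      + contour_integral (linepath ?b ?c) q + contour_integral (linepath ?c ?d) q
      + contour_integral (linepath ?d ?a) q"
    using int by (simp add: rectpath_def Let_def contour_integral_join contour_integrable_join)
  also have "contour_integral (linepath ?c ?d) q = - contour_integral (linepath ?d ?c) q"
    using contour_integral_reversepath[of "linepath ?d ?c" q] by simp
  also have "contour_integral (linepath ?d ?a) q = - contour_integral (linepath ?a ?d) q"
    using contour_integral_reversepath[of "linepath ?a ?d" q] by simp
  also have "contour_integral (linepath ?a ?d) q = \<i> * integral {0..Y} (\<lambda>s. q (Complex (-R) s))"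
    using assms by (intro contour_integral_linepath_same_Re) auto
  also have "contour_integral (linepath ?b ?c) q = \<i> * integral {0..Y} (\<lambda>s. q (Complex R s))"
    using assms by (intro contour_integral_linepath_same_Re) auto
  finally show ?thesis
    using assms by (simp add: contour_integral_linepath_horizontal)
qed

text \<open>A weighted arithmetic-geometric mean inequality: the weight \<open>s\<close> balances a numerator with
  bounded square integral against a Cauchy kernel with small square integral.\<close>

lemma norm_divide_le_squares:
  fixes a b :: complex
  assumes "s > 0"
  shows "norm (a / b) \<le> (norm a)\<^sup>2 / s + s * (1 / (norm b)\<^sup>2)"
proof -
  define B where "B = inverse (norm b)"
  have "0 \<le> (norm a - s * B)\<^sup>2 / s"
    using assms by simp
  also have "\<dots> = (norm a)\<^sup>2 / s + s * B\<^sup>2 - 2 * (norm a * B)"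
    using assms by (simp add: power2_eq_square field_simps)
  also have "\<dots> = (norm a)\<^sup>2 / s + s * (1 / (norm b)\<^sup>2) - 2 * norm (a / b)"
  proof -
    have "B\<^sup>2 = 1 / (norm b)\<^sup>2" "norm (a / b) = norm a * B"
      by (simp_all add: B_def norm_divide inverse_eq_divide power_divide)
    then show ?thesis by simp
  qed
  finally have "2 * norm (a / b) \<le> (norm a)\<^sup>2 / s + s * (1 / (norm b)\<^sup>2)"
    by simp
  moreover have "0 \<le> norm (a / b)" by (rule norm_ge_zero)
  ultimately show ?thesis by linarith
qed

lemma norm_Complex_diff_square: "(cmod (Complex x y - z))\<^sup>2 = (x - Re z)\<^sup>2 + (y - Im z)\<^sup>2"
  by (simp add: cmod_power2)

lemma integral_eq_nn_integral_indicator: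
  fixes g :: "real \<Rightarrow> real"
  assumes "continuous_on {a..b} g" "\<And>x. g x \<ge> 0"
  shows "ennreal (integral {a..b} g) = (\<integral>\<^sup>+x. indicator {a..b} x * ennreal (g x) \<partial>lborel)"
proof -
  have "set_integrable lborel {a..b} g"
    using assms(1) by (rule borel_integrable_atLeastAtMost')
  then have "ennreal (integral {a..b} g) = ennreal (LINT x:{a..b}|lborel. g x)"
    by (simp add: set_borel_integral_eq_integral)
  also have "\<dots> = (\<integral>\<^sup>+x. ennreal (indicator {a..b} x *\<^sub>R g x) \<partial>lborel)"
    unfolding set_lebesgue_integral_def using \<open>set_integrable lborel {a..b} g\<close> assms(2)
    by (intro nn_integral_eq_integral[symmetric]) (auto simp: set_integrable_def)
  also have "\<dots> = (\<integral>\<^sup>+x. indicator {a..b} x * ennreal (g x) \<partial>lborel)"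
    by (intro nn_integral_cong) (simp add: indicator_def)
  finally show ?thesis .
qed

context H2_closed_half_plane
begin

lemma cauchy_kernel_integrable:
  assumes "y \<ge> 0" "y \<noteq> Im z"
  shows "integrable lborel (\<lambda>x. h (Complex x y) / (Complex x y - z))"
proof -
  have "(y - Im z)\<^sup>2 = \<bar>y - Im z\<bar>\<^sup>2" by simp
  then have "integrable lborel (\<lambda>x. 1 / (cmod (Complex x y - z))\<^sup>2)"
    unfolding norm_Complex_diff_square
    using poisson_kernel(1)[of "\<bar>y - Im z\<bar>" "Re z"] assms by simp
  then have "integrable lborel (\<lambda>x. (cmod (h (Complex x y)))\<^sup>2 / 1 + 1 * (1 / (cmod (Complex x y - z))\<^sup>2))"
    using line_integrable[OF assms(1)] by simp
  then show ?thesis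
  proof (rule Bochner_Integration.integrable_bound)
    have "continuous_on UNIV (\<lambda>x. h (Complex x y) / (Complex x y - z))"
      using assms by (intro continuous_intros line_continuous) (auto simp: complex_eq_iff)
    then show "(\<lambda>x. h (Complex x y) / (Complex x y - z)) \<in> borel_measurable lborel"
      by (simp add: borel_measurable_continuous_onI)
    show "AE x in lborel. cmod (h (Complex x y) / (Complex x y - z))
            \<le> norm ((cmod (h (Complex x y)))\<^sup>2 / 1 + 1 * (1 / (cmod (Complex x y - z))\<^sup>2))"
      using norm_divide_le_squares[of 1] by (auto intro!: always_eventually order_trans[OF _ abs_ge_self])
  qed
qed

lemma horizontal_side_bound:
  assumes "Y \<ge> 0" "Y > Im z"
  shows "cmod (integral {-R..R} (\<lambda>x. h (Complex x Y) / (Complex x Y - z)))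
           \<le> (M + pi) / sqrt (Y - Im z)"
proof -
  let ?q = "\<lambda>x. h (Complex x Y) / (Complex x Y - z)"
  \<comment> \<open>The square integral of the Cauchy kernel at height \<open>Y\<close> is \<open>\<pi> / (Y - Im z)\<close>; this weight
     makes both terms of the mean inequality of order \<open>1 / sqrt (Y - Im z)\<close>.\<close>
  define s where "s = sqrt (Y - Im z)"
  have s: "s > 0" "s\<^sup>2 = Y - Im z" using assms by (auto simp: s_def)
  have int: "integrable lborel ?q"
    using assms by (intro cauchy_kernel_integrable) auto
  have set_int: "set_integrable lborel {-R..R} ?q"
    unfolding set_integrable_def by (intro integrable_mult_indicator int) auto
  have int2: "integrable lborel (\<lambda>x. (cmod (h (Complex x Y)))\<^sup>2 / s + s * (1 / (cmod (Complex x Y - z))\<^sup>2))"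
    unfolding norm_Complex_diff_square 
    using assms by (intro Bochner_Integration.integrable_add integrable_divide integrable_mult_right
        line_integrable poisson_kernel(1)) auto
  have "cmod (integral {-R..R} ?q) = cmod (LINT x:{-R..R}|lborel. ?q x)"
    using set_int by (simp add: set_borel_integral_eq_integral)
  also have "\<dots> \<le> (LINT x|lborel. (cmod (h (Complex x Y)))\<^sup>2 / s + s * (1 / (cmod (Complex x Y - z))\<^sup>2))"
    unfolding set_lebesgue_integral_def
  proof (intro Bochner_Integration.integral_norm_bound_integral)
    fix x
    have "0 \<le> (cmod (h (Complex x Y)))\<^sup>2 / s + s * (1 / (cmod (Complex x Y - z))\<^sup>2)"
      using s by simp
    then show "cmod (indicat_real {-R..R} x *\<^sub>R ?q x)
        \<le> (cmod (h (Complex x Y)))\<^sup>2 / s + s * (1 / (cmod (Complex x Y - z))\<^sup>2)"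
      using norm_divide_le_squares[OF s(1)] by (simp add: indicator_def)
  qed (use int2 set_int in \<open>auto simp: set_integrable_def\<close>)
  also have "\<dots> = (LINT x|lborel. (cmod (h (Complex x Y)))\<^sup>2) / s + s * (pi / (Y - Im z))"
  proof -
    define P where "P = (\<lambda>x. 1 / (cmod (Complex x Y - z))\<^sup>2)"
    have P_eq: "P x = 1 / (cmod (Complex x Y - z))\<^sup>2" for x
      by (simp add: P_def)
    have "integrable lborel P" "(LINT x|lborel. P x) = pi / (Y - Im z)"
      unfolding P_def norm_Complex_diff_square using assms by (auto intro: poisson_kernel)
    then show ?thesis
      using line_integrable[OF assms(1)] by (simp only: P_eq[symmetric]) simp
  qed
  also have "\<dots> \<le> M / s + s * (pi / (Y - Im z))"
    using s line_integral_le[of Y] assms by (intro add_mono divide_right_mono) auto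
  also have "\<dots> = (M + pi) / s"
    using s(1) unfolding s(2)[symmetric] by (simp add: power2_eq_square add_divide_distrib)
  finally show ?thesis by (simp add: s_def)
qed

lemma vertical_side_bound:
  assumes "Y > 0" "\<bar>x\<bar> > \<bar>Re z\<bar>"
    and le: "(\<integral>\<^sup>+s. indicator {0..Y} s * ennreal ((cmod (h (Complex x s)))\<^sup>2) \<partial>lborel) \<le> 1"
  shows "cmod (integral {0..Y} (\<lambda>s. h (Complex x s) / (Complex x s - z)))
           \<le> (1 + Y) / (\<bar>x\<bar> - \<bar>Re z\<bar>)"
proof -
  let ?d = "\<bar>x\<bar> - \<bar>Re z\<bar>"
  have cont': "continuous_on {0..Y} (\<lambda>s. h (Complex x s))"
    by (intro continuous_on_compose2[OF cont] continuous_intros) auto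
  then have cont2: "continuous_on {0..Y} (\<lambda>s. (cmod (h (Complex x s)))\<^sup>2)"
    by (intro continuous_intros)
  have ne: "Complex x s \<noteq> z" for s
    using assms(2) by auto
  have "ennreal (integral {0..Y} (\<lambda>s. (cmod (h (Complex x s)))\<^sup>2)) \<le> ennreal 1"
    using le by (subst integral_eq_nn_integral_indicator[OF cont2]) auto
  then have le1: "integral {0..Y} (\<lambda>s. (cmod (h (Complex x s)))\<^sup>2) \<le> 1"
    by (subst (asm) ennreal_le_iff) auto
  have "cmod (integral {0..Y} (\<lambda>s. h (Complex x s) / (Complex x s - z)))
      \<le> integral {0..Y} (\<lambda>s. ((cmod (h (Complex x s)))\<^sup>2 + 1) / ?d)"
  proof (rule integral_norm_bound_integral)
    show "(\<lambda>s. h (Complex x s) / (Complex x s - z)) integrable_on {0..Y}"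
      using ne by (intro integrable_continuous_real continuous_intros cont') auto
    show "(\<lambda>s. ((cmod (h (Complex x s)))\<^sup>2 + 1) / ?d) integrable_on {0..Y}"
      using assms(2) by (intro integrable_continuous_real continuous_intros cont') auto
    fix s
    have "?d \<le> \<bar>Re (Complex x s - z)\<bar>" by simp
    also have "\<dots> \<le> cmod (Complex x s - z)" by (rule abs_Re_le_cmod)
    finally have "?d \<le> cmod (Complex x s - z)" .
    moreover have "cmod (h (Complex x s)) \<le> (cmod (h (Complex x s)))\<^sup>2 + 1"
      using sum_power2_ge_zero[of "cmod (h (Complex x s)) - 1/2" 0]
      by (simp add: power2_eq_square algebra_simps)
    ultimately show "cmod (h (Complex x s) / (Complex x s - z)) \<le> ((cmod (h (Complex x s)))\<^sup>2 + 1) / ?d"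
      unfolding norm_divide using assms(2) by (intro frac_le) auto
  qed
  also have "\<dots> = (integral {0..Y} (\<lambda>s. (cmod (h (Complex x s)))\<^sup>2) + Y) / ?d"
    using \<open>Y > 0\<close> by (simp add: integral_divide Henstock_Kurzweil_Integration.integral_add 
        integrable_continuous_real cont2)
  also have "\<dots> \<le> (1 + Y) / ?d"
    using le1 assms(2) by (intro divide_right_mono) auto
  finally show ?thesis .
qed

text \<open>Both Cauchy's formula and Cauchy's theorem make the contour integral over all large rectangles
  constant. The height \<open>Y\<close> is chosen first, which makes the top side small for every width; the
  width \<open>R\<close> is then chosen among those for which the vertical sides are small, and the bottom side
  tends to the integral over the real line.\<close>

lemma boundary_integral_eq_contour_value:
  assumes "Im z \<noteq> 0"
    and val: "\<And>R Y. R > \<bar>Re z\<bar> \<Longrightarrow> Y > \<bar>Im z\<bar> \<Longrightarrow>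
      contour_integral (rectpath (Complex (-R) 0) (Complex R Y)) (\<lambda>\<zeta>. h \<zeta> / (\<zeta> - z)) = c"
  shows "(LINT t|lborel. h (of_real t) / (of_real t - z)) = c"
proof -
  define q where "q = (\<lambda>\<zeta>. h \<zeta> / (\<zeta> - z))"
  let ?I = "LINT t|lborel. q (Complex t 0)"
  have int: "integrable lborel (\<lambda>t. q (Complex t 0))"
    unfolding q_def using assms by (intro cauchy_kernel_integrable) auto
  have lim: "((\<lambda>R. LINT t|lborel. indicator {-R..R} t *\<^sub>R q (Complex t 0)) \<longlongrightarrow> ?I) at_top"
  proof (rule integral_dominated_convergence_at_top)
    show "integrable lborel (\<lambda>t. norm (q (Complex t 0)))"
      using int by simp
    show "(\<lambda>t. q (Complex t 0)) \<in> borel_measurable lborel" using int by simp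
    show "(\<lambda>t. indicat_real {- R..R} t *\<^sub>R q (Complex t 0)) \<in> borel_measurable lborel" for R
      using int by simp
    show "\<forall>\<^sub>F R in at_top. AE t in lborel. norm (indicat_real {- R..R} t *\<^sub>R q (Complex t 0)) \<le> norm (q (Complex t 0))"
      by (intro always_eventually allI) (auto simp: indicator_def)
    show "AE t in lborel. ((\<lambda>R. indicat_real {- R..R} t *\<^sub>R q (Complex t 0)) \<longlongrightarrow> q (Complex t 0)) at_top"
    proof (intro always_eventually allI)
      fix t :: real
      have "\<forall>\<^sub>F R in at_top. indicat_real {- R..R} t *\<^sub>R q (Complex t 0) = q (Complex t 0)"
        using eventually_ge_at_top[of "\<bar>t\<bar>"] by eventually_elim (auto simp: indicator_def)
      then show "((\<lambda>R. indicat_real {- R..R} t *\<^sub>R q (Complex t 0)) \<longlongrightarrow> q (Complex t 0)) at_top"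
        by (rule tendsto_eventually)
    qed
  qed
  have "norm (?I - c) \<le> 0 + e" if "e > 0" for e
  proof -
    define \<epsilon> where "\<epsilon> = e / 4"
    have \<epsilon>: "\<epsilon> > 0" using that by (simp add: \<epsilon>_def)
    define Y where "Y = \<bar>Im z\<bar> + 1 + ((M + pi) / \<epsilon>)\<^sup>2"
    have Y: "Y > 0" "Y > \<bar>Im z\<bar>" "Y > Im z" "Y \<ge> 0" "Y \<noteq> Im z"
    proof -
      have "Y \<ge> \<bar>Im z\<bar> + 1" by (simp add: Y_def)
      then show "Y > 0" "Y > \<bar>Im z\<bar>" "Y > Im z" "Y \<ge> 0" "Y \<noteq> Im z" by linarith+
    qed
    have top: "norm (integral {-R..R} (\<lambda>x. q (Complex x Y))) \<le> \<epsilon>" for R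
    proof -
      have "((M + pi) / \<epsilon>)\<^sup>2 \<le> Y - Im z" by (simp add: Y_def)
      then have "(M + pi) / \<epsilon> \<le> sqrt (Y - Im z)" by (rule real_le_rsqrt)
      then have "(M + pi) / sqrt (Y - Im z) \<le> \<epsilon>"
        using \<epsilon> Y by (simp add: field_simps)
      then show ?thesis
        unfolding q_def using horizontal_side_bound[of Y z R] Y by linarith
    qed
    have "\<forall>\<^sub>F R in at_top. norm ((LINT t|lborel. indicator {-R..R} t *\<^sub>R q (Complex t 0)) - ?I) < \<epsilon>"
      using lim \<epsilon> unfolding tendsto_iff dist_norm by blast
    then obtain n0 where n0: "\<And>R. R \<ge> n0 \<Longrightarrow>
        norm ((LINT t|lborel. indicator {-R..R} t *\<^sub>R q (Complex t 0)) - ?I) < \<epsilon>"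
      by (auto simp: eventually_at_top_linorder)
    define n where "n = max \<bar>n0\<bar> (\<bar>Re z\<bar> + (1 + Y) / \<epsilon>)"
    have "n \<ge> 0" by (simp add: n_def)
    obtain R where R: "R \<ge> n"
      and sides: "(\<integral>\<^sup>+s. indicator {0..Y} s * ennreal ((cmod (h (Complex R s)))\<^sup>2) \<partial>lborel) \<le> 1"
        "(\<integral>\<^sup>+s. indicator {0..Y} s * ennreal ((cmod (h (Complex (-R) s)))\<^sup>2) \<partial>lborel) \<le> 1"
      using vertical_sides_small[OF Y(1) \<open>n \<ge> 0\<close>] .
    have "R \<ge> \<bar>Re z\<bar> + (1 + Y) / \<epsilon>" "R \<ge> n0"
      using R by (auto simp: n_def)
    moreover have "(1 + Y) / \<epsilon> > 0" using Y \<epsilon> by simp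
    ultimately have R': "R > \<bar>Re z\<bar>" "R > 0" "R \<ge> n0" "(1 + Y) / \<epsilon> \<le> R - \<bar>Re z\<bar>"
      by linarith+
    have side_small: "(1 + Y) / (R - \<bar>Re z\<bar>) \<le> \<epsilon>"
      using R'(1,4) \<epsilon> by (simp add: field_simps)
    have right: "norm (integral {0..Y} (\<lambda>s. q (Complex R s))) \<le> \<epsilon>"
      unfolding q_def using vertical_side_bound[OF Y(1) _ sides(1), of z] R' side_small by simp
    have left: "norm (integral {0..Y} (\<lambda>s. q (Complex (-R) s))) \<le> \<epsilon>"
      unfolding q_def using vertical_side_bound[OF Y(1) _ sides(2), of z] R' side_small by simp
    have "continuous_on (path_image (rectpath (Complex (-R) 0) (Complex R Y))) q"
      unfolding q_def using R' Y \<open>Im z \<noteq> 0\<close>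
      by (intro continuous_intros continuous_on_subset[OF cont])
        (auto simp: path_image_rectpath)
    then have "c = integral {-R..R} (\<lambda>x. q (Complex x 0)) + \<i> * integral {0..Y} (\<lambda>s. q (Complex R s))
      - integral {-R..R} (\<lambda>x. q (Complex x Y)) - \<i> * integral {0..Y} (\<lambda>s. q (Complex (-R) s))"
      using contour_integral_rectpath_sides[of R Y q] val[of R Y] R' Y by (simp add: q_def)
    moreover have "integral {-R..R} (\<lambda>x. q (Complex x 0)) = (LINT t|lborel. indicator {-R..R} t *\<^sub>R q (Complex t 0))"
    proof -
      have "set_integrable lborel {-R..R} (\<lambda>x. q (Complex x 0))"
        unfolding set_integrable_def by (intro integrable_mult_indicator int) auto
      then show ?thesis
        by (simp add: set_borel_integral_eq_integral(2)[symmetric] set_lebesgue_integral_def)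
    qed
    ultimately have "?I - c = - ((LINT t|lborel. indicator {-R..R} t *\<^sub>R q (Complex t 0)) - ?I)
       - \<i> * integral {0..Y} (\<lambda>s. q (Complex R s))
       + integral {-R..R} (\<lambda>x. q (Complex x Y)) + \<i> * integral {0..Y} (\<lambda>s. q (Complex (-R) s))"
      by simp
    also have "norm \<dots> \<le> \<epsilon> + \<epsilon> + \<epsilon> + \<epsilon>"
      using n0[OF R'(3)] right left top[of R]
      by (intro norm_triangle_mono norm_triangle_le_diff) 
         (auto simp: norm_mult norm_minus_commute intro!: order_trans[OF norm_triangle_ineq4] add_mono)
    finally show ?thesis by (simp add: \<epsilon>_def)
  qed
  then have "norm (?I - c) \<le> 0"
    by (rule field_le_epsilon)
  then show ?thesis
    by (simp add: q_def Complex_eq)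
qed

lemma cauchy_upper:
  assumes "Im z > 0"
  shows "(LINT t|lborel. h (of_real t) / (of_real t - z)) = 2 * pi * \<i> * h z"
proof (rule boundary_integral_eq_contour_value)
  fix R Y :: real assume RY: "R > \<bar>Re z\<bar>" "Y > \<bar>Im z\<bar>"
  let ?\<gamma> = "rectpath (Complex (-R) 0) (Complex R Y)"
  have z: "z \<in> box (Complex (-R) 0) (Complex R Y)"
    using RY assms by (auto simp: in_box_complex_iff)
  have img: "path_image ?\<gamma> = cbox (Complex (-R) 0) (Complex R Y) - box (Complex (-R) 0) (Complex R Y)"
    using RY by (intro path_image_rectpath_cbox_minus_box) auto
  have "((\<lambda>\<zeta>. h \<zeta> / (\<zeta> - z)) has_contour_integral
          2 * pi * \<i> * winding_number ?\<gamma> z * h z) ?\<gamma>"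
  proof (rule Cauchy_integral_formula_convex_simple[OF _ holo])
    show "convex {z. 0 \<le> Im z}" by (rule convex_halfspace_Im_ge)
    have "{z. 0 < Im z} \<subseteq> interior {z. 0 \<le> Im z}"
      by (intro interior_maximal open_halfspace_Im_gt) auto
    then show "z \<in> interior {z. 0 \<le> Im z}" using assms by auto
    show "path_image ?\<gamma> \<subseteq> {z. 0 \<le> Im z} - {z}"
      using z unfolding img by (auto simp: in_cbox_complex_iff)
  qed auto
  then show "contour_integral ?\<gamma> (\<lambda>\<zeta>. h \<zeta> / (\<zeta> - z)) = 2 * pi * \<i> * h z"
    using winding_number_rectpath[OF z] by (auto dest: contour_integral_unique)
qed (use assms in auto)

lemma cauchy_lower:
  assumes "Im z < 0"
  shows "(LINT t|lborel. h (of_real t) / (of_real t - z)) = 0"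
proof (rule boundary_integral_eq_contour_value)
  fix R Y :: real assume RY: "R > \<bar>Re z\<bar>" "Y > \<bar>Im z\<bar>"
  let ?\<gamma> = "rectpath (Complex (-R) 0) (Complex R Y)"
  have img: "path_image ?\<gamma> \<subseteq> cbox (Complex (-R) 0) (Complex R Y)"
    using RY by (intro path_image_rectpath_subset_cbox) auto
  have "((\<lambda>\<zeta>. h \<zeta> / (\<zeta> - z)) has_contour_integral 0) ?\<gamma>"
  proof (rule Cauchy_theorem_convex_simple)
    show "(\<lambda>\<zeta>. h \<zeta> / (\<zeta> - z)) holomorphic_on {z. 0 \<le> Im z}"
      using assms by (intro holomorphic_intros holo) auto
    show "convex {z. 0 \<le> Im z}" by (rule convex_halfspace_Im_ge)
    show "path_image ?\<gamma> \<subseteq> {z. 0 \<le> Im z}"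
      using img by (auto simp: in_cbox_complex_iff)
  qed auto
  then show "contour_integral ?\<gamma> (\<lambda>\<zeta>. h \<zeta> / (\<zeta> - z)) = 0"
    by (rule contour_integral_unique)
qed (use assms in auto)

end

section \<open>No poles on the real line\<close>

text \<open>The reciprocal of a function with a pole extends analytically with value \<open>0\<close>, so it is at most
  linear near the pole.\<close>

lemma pole_growth:
  assumes pole: "is_pole q z" and "isolated_singularity_at q z"
  obtains C r where "C > 0" "r > 0"
    "\<And>w. w \<noteq> z \<Longrightarrow> dist w z < r \<Longrightarrow> 1 \<le> C * cmod (w - z) * cmod (q w)"
proof -
  from assms(2) obtain r1 where r1: "r1 > 0" "q analytic_on ball z r1 - {z}"
    by (auto simp: isolated_singularity_at_def)
  from non_zero_neighbour_pole[OF pole] obtain r2 where r2: "r2 > 0"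
    "\<And>w. w \<noteq> z \<Longrightarrow> dist w z < r2 \<Longrightarrow> q w \<noteq> 0"
    by (auto simp: eventually_at)
  define B where "B = ball z (min r1 r2)"
  define p where "p = (\<lambda>w. if w = z then 0 else inverse (q w))"
  have B: "open B" "z \<in> B" using r1 r2 by (auto simp: B_def)
  have "p holomorphic_on B"
    unfolding p_def
  proof (rule is_pole_inverse_holomorphic[OF B(1) _ pole])
    show "q holomorphic_on B - {z}"
      using r1(2) by (intro analytic_imp_holomorphic) (auto elim!: analytic_on_subset simp: B_def)
    show "\<forall>w\<in>B - {z}. q w \<noteq> 0"
      using r2 by (auto simp: B_def dist_commute)
  qed
  then have "(p has_field_derivative deriv p z) (at z)"
    using B by (intro holomorphic_derivI)
  then have "((\<lambda>w. cmod ((p w - p z) / (w - z))) \<longlongrightarrow> cmod (deriv p z)) (at z)"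
    unfolding has_field_derivative_iff by (rule tendsto_norm)
  then have "\<forall>\<^sub>F w in at z. cmod ((p w - p z) / (w - z)) < cmod (deriv p z) + 1"
    by (rule order_tendstoD) simp
  then obtain r3 where r3: "r3 > 0"
    "\<And>w. w \<noteq> z \<Longrightarrow> dist w z < r3 \<Longrightarrow> cmod ((p w - p z) / (w - z)) < cmod (deriv p z) + 1"
    by (auto simp: eventually_at)
  show thesis
  proof (rule that[of "cmod (deriv p z) + 1" "min r2 r3"])
    show "0 < cmod (deriv p z) + 1" by (simp add: add_nonneg_pos)
    show "0 < min r2 r3" using r2 r3 by simp
    fix w assume w: "w \<noteq> z" "dist w z < min r2 r3"
    have "q w \<noteq> 0" using r2 w by simp
    moreover from w have "cmod (inverse (q w)) \<le> (cmod (deriv p z) + 1) * cmod (w - z)"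
      using r3(2)[of w] w by (simp add: p_def norm_divide divide_less_eq less_imp_le)
    then have "cmod (inverse (q w)) * cmod (q w) \<le> (cmod (deriv p z) + 1) * cmod (w - z) * cmod (q w)"
      by (intro mult_right_mono) auto
    ultimately show "1 \<le> (cmod (deriv p z) + 1) * cmod (w - z) * cmod (q w)"
      by (simp add: norm_inverse)
  qed
qed

text \<open>Near a real pole \<open>a\<close> the function is at least of order \<open>1 / y\<close> on the segment of length \<open>2 y\<close> at height
  \<open>y\<close> above \<open>a\<close>, so its square integral over that line is at least of order \<open>1 / y\<close>.\<close>

lemma hardy_H2_no_real_pole:
  assumes f: "f \<in> hardy_H2" and iso: "isolated_singularity_at f (of_real a)"
  shows "\<not> is_pole f (of_real a)"
proof
  assume "is_pole f (of_real a)"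
  from pole_growth[OF this iso] obtain C r where C: "C > 0" and r: "r > 0"
    and growth: "\<And>w. w \<noteq> of_real a \<Longrightarrow> dist w (of_real a) < r \<Longrightarrow>
       1 \<le> C * cmod (w - of_real a) * cmod (f w)"
    by blast
  obtain M where M: "M \<ge> 0"
    "\<And>y. y > 0 \<Longrightarrow> (\<integral>\<^sup>+x. ennreal ((cmod (f (Complex x y)))\<^sup>2) \<partial>lborel) \<le> ennreal M"
    using hardy_H2_bound[OF f] by blast
  \<comment> \<open>Small enough for the growth estimate to hold on the segment, and for the lower bound
     \<open>1 / (C\<^sup>2 y)\<close> obtained below to exceed \<open>M\<close>.\<close>
  define y where "y = min (r / 4) (1 / (C\<^sup>2 * (M + 1)))"
  have y: "y > 0" using r C M by (auto simp: y_def)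
  have "2 * y < r" using r by (simp add: y_def min_def)
  have low: "indicator {a-y..a+y} x * ennreal (1 / (2 * C\<^sup>2 * y\<^sup>2)) \<le> ennreal ((cmod (f (Complex x y)))\<^sup>2)" for x
  proof (cases "x \<in> {a-y..a+y}")
    case True
    let ?w = "Complex x y"
    have "cmod (?w - of_real a)^2 = (x - a)\<^sup>2 + y\<^sup>2"
      by (simp add: cmod_power2)
    moreover have "(x - a)\<^sup>2 \<le> y\<^sup>2"
      using True by (intro abs_le_square_iff[THEN iffD1]) auto
    ultimately have sq: "cmod (?w - of_real a)^2 \<le> 2 * y\<^sup>2" by simp
    also have "\<dots> \<le> (2 * y)\<^sup>2" by (simp add: power2_eq_square)
    finally have "cmod (?w - of_real a) \<le> 2 * y"
      by (rule power2_le_imp_le) (use y in auto)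
    then have "dist ?w (of_real a) < r"
      using \<open>2 * y < r\<close> by (simp add: dist_norm)
    moreover have "?w \<noteq> of_real a" using y by (auto simp: complex_eq_iff)
    ultimately have "1 \<le> C * cmod (?w - of_real a) * cmod (f ?w)"
      by (intro growth)
    then have "1\<^sup>2 \<le> (C * cmod (?w - of_real a) * cmod (f ?w))\<^sup>2"
      by (intro power_mono) auto
    also have "\<dots> = C\<^sup>2 * (cmod (f ?w))\<^sup>2 * cmod (?w - of_real a)^2"
      by (simp add: power_mult_distrib)
    also have "\<dots> \<le> C\<^sup>2 * (cmod (f ?w))\<^sup>2 * (2 * y\<^sup>2)"
      by (intro mult_left_mono sq) auto
    finally have "1 / (2 * C\<^sup>2 * y\<^sup>2) \<le> (cmod (f ?w))\<^sup>2"
      using C y by (simp add: field_simps)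
    then show ?thesis using True by (simp add: ennreal_leI)
  qed simp
  have "ennreal (1 / (C\<^sup>2 * y)) = (\<integral>\<^sup>+x. indicator {a-y..a+y} x * ennreal (1 / (2 * C\<^sup>2 * y\<^sup>2)) \<partial>lborel)"
    using y C by (simp add: nn_integral_multc ennreal_mult'[symmetric] power2_eq_square)
  also have "\<dots> \<le> (\<integral>\<^sup>+x. ennreal ((cmod (f (Complex x y)))\<^sup>2) \<partial>lborel)"
    by (intro nn_integral_mono low)
  also have "\<dots> \<le> ennreal M" using y by (rule M)
  finally have "1 / (C\<^sup>2 * y) \<le> M"
    using M by simp
  moreover have "M + 1 \<le> 1 / (C\<^sup>2 * y)"
  proof -
    have "y \<le> 1 / (C\<^sup>2 * (M + 1))" by (simp add: y_def)
    moreover have "C\<^sup>2 * (M + 1) > 0" using C M by simp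
    ultimately have "y * (C\<^sup>2 * (M + 1)) \<le> 1" by (subst (asm) pos_le_divide_eq)
    then have "(M + 1) * (C\<^sup>2 * y) \<le> 1" by (simp only: mult_ac)
    moreover have "C\<^sup>2 * y > 0" using C y by simp
    ultimately show ?thesis by (subst pos_le_divide_eq)
  qed
  ultimately show False by simp
qed

lemma entire_sharp:
  assumes "entire f" shows "entire (sharp f)"
proof -
  have "cnj \<circ> f \<circ> cnj holomorphic_on UNIV"
    using assms by (intro holomorphic_on_compose_cnj_cnj) (auto simp: entire_def elim: holomorphic_on_subset)
  moreover have "cnj \<circ> f \<circ> cnj = sharp f"
    by (auto simp: sharp_def)
  ultimately show ?thesis by (simp add: entire_def)
qed

lemma sharp_sharp [simp]: "sharp (sharp f) = f"
  by (auto simp: sharp_def)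

lemma sharp_of_real [simp]: "sharp f (of_real t) = cnj (f (of_real t))"
  by (simp add: sharp_def)

lemma entire_continuous: "entire f \<Longrightarrow> continuous_on A f"
  unfolding entire_def by (meson continuous_on_subset holomorphic_on_imp_continuous_on subset_UNIV)

lemma entire_measurable_real: "entire f \<Longrightarrow> (\<lambda>t. f (of_real t)) \<in> borel_measurable borel"
  by (intro borel_measurable_continuous_onI continuous_on_compose2[OF entire_continuous[of f UNIV]]
       continuous_intros) auto

lemma entire_analytic: "entire f \<Longrightarrow> f analytic_on A"
  unfolding entire_def by (metis analytic_on_open analytic_on_subset open_UNIV subset_UNIV)

section \<open>The space of a Hermite-Biehler function\<close>

locale HB =
  fixes E :: "complex \<Rightarrow> complex"
  assumes HB: "hermite_biehler E"
begin

lemma E_entire: "entire E"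
  using HB by (simp add: hermite_biehler_def)

lemma E_less: "Im z > 0 \<Longrightarrow> cmod (E (cnj z)) < cmod (E z)"
  using HB by (simp add: hermite_biehler_def upper_half_plane_def)

lemma E_nonzero: "Im z > 0 \<Longrightarrow> E z \<noteq> 0"
  using E_less[of z] by auto

lemma E_real_nonzero_AE: "AE t in lborel. E (of_real t) \<noteq> 0"
proof -
  have "\<not> E constant_on UNIV"
  proof
    assume "E constant_on UNIV"
    then have "E (cnj \<i>) = E \<i>" by (metis UNIV_I constant_on_def)
    then show False using E_less[of \<i>] by simp
  qed
  then have "countable {z\<in>UNIV. E z = 0}"
    using E_entire by (intro holomorphic_countable_zeros) (auto simp: entire_def)
  moreover have "of_real ` {t::real. E (of_real t) = 0} \<subseteq> {z\<in>UNIV. E z = 0}"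
    by auto
  ultimately have "countable (complex_of_real ` {t. E (of_real t) = 0})"
    by (rule countable_subset[rotated])
  then have "countable {t::real. E (of_real t) = 0}"
    by (rule countable_image_inj_on) (simp add: inj_on_def)
  from AE_not_in[OF countable_imp_null_set_lborel[OF this]] show ?thesis
    by simp
qed

definition ext :: "(complex \<Rightarrow> complex) \<Rightarrow> complex \<Rightarrow> complex" where
  "ext f = remove_sings (\<lambda>z. f z / E z)"

lemma ext_eq:
  assumes "entire f" "E z \<noteq> 0" shows "ext f z = f z / E z"
  unfolding ext_def using assms E_entire
  by (intro remove_sings_at_analytic analytic_intros entire_analytic) auto

lemma ext_H2:
  assumes f: "entire f" and H2: "(\<lambda>z. f z / E z) \<in> hardy_H2"
  obtains M where "H2_closed_half_plane (ext f) M"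
proof -
  let ?q = "\<lambda>z. f z / E z"
  have mero: "?q meromorphic_on {z}" for z
    by (intro meromorphic_intros analytic_on_imp_meromorphic_on entire_analytic f E_entire)
  have ana: "ext f analytic_on {z}" if "Im z \<ge> 0" for z
  proof (cases "E z = 0")
    case False
    then show ?thesis unfolding ext_def using f E_entire
      by (intro remove_sings_analytic_on analytic_intros entire_analytic) auto
  next
    case True
    then have "Im z = 0" using E_nonzero[of z] that by force
    then have z: "z = of_real (Re z)" by (simp add: complex_eq_iff)
    have iso: "isolated_singularity_at ?q z" and "not_essential ?q z"
      using mero[of z] by (auto simp: meromorphic_at_iff)
    moreover have "\<not> is_pole ?q z"
      using hardy_H2_no_real_pole[OF H2, of "Re z"] iso z by simp
    ultimately obtain c where "?q \<midarrow>z\<rightarrow> c"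
      by (auto simp: not_essential_def)
    with iso show ?thesis unfolding ext_def by (rule remove_sings_analytic_at)
  qed
  obtain M where M: "M \<ge> 0"
    "\<And>y. y > 0 \<Longrightarrow> (\<integral>\<^sup>+x. ennreal ((cmod (?q (Complex x y)))\<^sup>2) \<partial>lborel) \<le> ennreal M"
    using hardy_H2_bound[OF H2] by blast
  show thesis
  proof (rule that[of M], unfold_locales)
    show "ext f analytic_on {z. 0 \<le> Im z}"
      by (subst analytic_on_analytic_at) (auto intro: ana)
    show "0 \<le> M" by fact
    fix y :: real assume "y > 0"
    then show "(\<integral>\<^sup>+x. ennreal ((cmod (ext f (Complex x y)))\<^sup>2) \<partial>lborel) \<le> ennreal M"
      using M(2)[of y] by (simp add: ext_eq[OF f] E_nonzero)
  qed
qed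

lemma de_brangesD:
  assumes "f \<in> de_branges E"
  shows "entire f" "(\<lambda>z. f z / E z) \<in> hardy_H2" "(\<lambda>z. sharp f z / E z) \<in> hardy_H2"
  using assms by (auto simp: de_branges_def)

lemma ext_AE: "entire f \<Longrightarrow> AE t in lborel. ext f (of_real t) = f (of_real t) / E (of_real t)"
  using E_real_nonzero_AE by eventually_elim (rule ext_eq)

lemma sharp_mem:
  assumes "f \<in> de_branges E" shows "sharp f \<in> de_branges E"
  using de_brangesD[OF assms] by (auto simp: de_branges_def entire_sharp)

lemma square_integrable:
  assumes "f \<in> de_branges E"
  shows "integrable lborel (\<lambda>t. (cmod (f (of_real t) / E (of_real t)))\<^sup>2)"
proof -
  note f = de_brangesD[OF assms]
  obtain M where "H2_closed_half_plane (ext f) M"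
    using ext_H2[OF f(1,2)] .
  then interpret H2_closed_half_plane "ext f" M .
  have "integrable lborel (\<lambda>t. (cmod (ext f (of_real t)))\<^sup>2)"
    using line_integrable[of 0] by (simp add: Complex_eq)
  moreover have "(\<lambda>t. (cmod (f (of_real t) / E (of_real t)))\<^sup>2) \<in> borel_measurable lborel"
    using entire_measurable_real[OF f(1)] entire_measurable_real[OF E_entire] by simp
  moreover have "AE t in lborel. (cmod (ext f (of_real t)))\<^sup>2 = (cmod (f (of_real t) / E (of_real t)))\<^sup>2"
    using ext_AE[OF f(1)] by eventually_elim simp
  ultimately show ?thesis
    by (rule Bochner_Integration.integrable_cong_AE_imp)
qed

text \<open>The values on the real line of \<open>f / E\<close> and of its extension differ only at real zeros of \<open>E\<close>,
  a countable set.\<close>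

lemma cauchy_transform:
  assumes "entire f" "(\<lambda>z. f z / E z) \<in> hardy_H2" "Im z \<noteq> 0"
  shows "integrable lborel (\<lambda>t. f (of_real t) / E (of_real t) / (of_real t - z))" (is ?int)
    and "Im z > 0 \<Longrightarrow> (LINT t|lborel. f (of_real t) / E (of_real t) / (of_real t - z)) = 2 * pi * \<i> * (f z / E z)"
      (is "_ \<Longrightarrow> ?upper")
    and "Im z < 0 \<Longrightarrow> (LINT t|lborel. f (of_real t) / E (of_real t) / (of_real t - z)) = 0"
      (is "_ \<Longrightarrow> ?lower")
proof -
  obtain M where "H2_closed_half_plane (ext f) M"
    using ext_H2[OF assms(1,2)] .
  then interpret H2_closed_half_plane "ext f" M .
  have AE: "AE t in lborel. ext f (of_real t) / (of_real t - z) = f (of_real t) / E (of_real t) / (of_real t - z)"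
    using ext_AE[OF assms(1)] by eventually_elim simp
  have int: "integrable lborel (\<lambda>t. ext f (of_real t) / (of_real t - z))"
    using cauchy_kernel_integrable[of 0 z] assms(3) by (simp add: Complex_eq)
  have meas: "(\<lambda>t. f (of_real t) / E (of_real t) / (of_real t - z)) \<in> borel_measurable lborel"
    using entire_measurable_real[OF assms(1)] entire_measurable_real[OF E_entire] by simp
  show ?int
    using integrable_cong_AE[OF borel_measurable_integrable[OF int] meas AE] int by simp
  have eq: "(LINT t|lborel. f (of_real t) / E (of_real t) / (of_real t - z))
     = (LINT t|lborel. ext f (of_real t) / (of_real t - z))"
    using integral_cong_AE[OF borel_measurable_integrable[OF int] meas AE] by simp
  show ?upper if "Im z > 0"
    unfolding eq using cauchy_upper[OF that] that by (simp add: ext_eq[OF assms(1)] E_nonzero)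
  show ?lower if "Im z < 0"
    unfolding eq by (rule cauchy_lower[OF that])
qed

end

section \<open>The reproducing kernel\<close>

lemma hardy_H2_quadratic_decay:
  assumes holo: "F holomorphic_on upper_half_plane" and \<delta>: "\<delta> > 0"
    and le: "\<And>z. Im z > 0 \<Longrightarrow> (cmod (F z))\<^sup>2 * ((Re z - u)\<^sup>2 + \<delta>\<^sup>2) \<le> A"
  shows "F \<in> hardy_H2"
proof (rule hardy_H2_I[OF holo])
  fix y :: real assume y: "y > 0"
  have "0 \<le> (cmod (F \<i>))\<^sup>2 * ((Re \<i> - u)\<^sup>2 + \<delta>\<^sup>2)" by simp
  also have "\<dots> \<le> A" by (rule le) simp
  finally have "A \<ge> 0" .
  have pos: "(x - u)\<^sup>2 + \<delta>\<^sup>2 > 0" for x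
    using \<delta> by (simp add: add_nonneg_pos)
  have "(\<integral>\<^sup>+x. ennreal ((cmod (F (Complex x y)))\<^sup>2) \<partial>lborel)
      \<le> (\<integral>\<^sup>+x. ennreal (A * (1 / ((x - u)\<^sup>2 + \<delta>\<^sup>2))) \<partial>lborel)"
  proof (intro nn_integral_mono ennreal_leI)
    fix x
    show "(cmod (F (Complex x y)))\<^sup>2 \<le> A * (1 / ((x - u)\<^sup>2 + \<delta>\<^sup>2))"
      using le[of "Complex x y"] y pos[of x] by (simp add: pos_le_divide_eq)
  qed
  also have "\<dots> = ennreal (LINT x|lborel. A * (1 / ((x - u)\<^sup>2 + \<delta>\<^sup>2)))"
    using \<open>A \<ge> 0\<close> pos by (intro nn_integral_eq_integral integrable_mult_right poisson_kernel(1) \<delta>)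
      (auto intro!: always_eventually divide_nonneg_pos)
  finally show "(\<integral>\<^sup>+x. ennreal ((cmod (F (Complex x y)))\<^sup>2) \<partial>lborel)
      \<le> ennreal (LINT x|lborel. A * (1 / ((x - u)\<^sup>2 + \<delta>\<^sup>2)))" .
qed

text \<open>A bound by a multiple of \<open>1 / \<bar>z - w\<bar>\<close> suffices even when \<open>w\<close> lies in the upper half-plane: there
  the bound says nothing at \<open>w\<close>, but \<open>F\<close> is bounded on a compact disc around \<open>w\<close>, and outside the disc
  \<open>\<bar>z - w\<bar>\<^sup>2\<close> dominates the denominator of a Poisson kernel up to a factor \<open>2\<close>.\<close>

lemma hardy_H2_decay:
  assumes holo: "F holomorphic_on upper_half_plane" and w: "Im w \<noteq> 0"
    and le: "\<And>z. Im z > 0 \<Longrightarrow> cmod (F z) * cmod (z - w) \<le> C"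
  shows "F \<in> hardy_H2"
proof -
  have le2: "(cmod (F z))\<^sup>2 * (cmod (z - w))\<^sup>2 \<le> C\<^sup>2" if "Im z > 0" for z
    using power_mono[OF le[OF that], of 2] by (simp add: power_mult_distrib)
  have dist2: "(cmod (z - w))\<^sup>2 = (Re z - Re w)\<^sup>2 + (Im z - Im w)\<^sup>2" for z
    by (simp add: cmod_power2)
  show ?thesis
  proof (cases "Im w < 0")
    case True
    show ?thesis
    proof (rule hardy_H2_quadratic_decay[OF holo])
      show "0 < - Im w" using True by simp
      fix z assume z: "Im z > 0"
      have "(- Im w)\<^sup>2 \<le> (Im z - Im w)\<^sup>2"
        using z True by (intro power_mono) auto
      then have "(cmod (F z))\<^sup>2 * ((Re z - Re w)\<^sup>2 + (- Im w)\<^sup>2) \<le> (cmod (F z))\<^sup>2 * (cmod (z - w))\<^sup>2"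
        unfolding dist2 by (intro mult_left_mono) auto
      with le2[OF z] show "(cmod (F z))\<^sup>2 * ((Re z - Re w)\<^sup>2 + (- Im w)\<^sup>2) \<le> C\<^sup>2"
        by linarith
    qed
  next
    case False
    define \<delta> where "\<delta> = Im w / 2"
    have \<delta>: "\<delta> > 0" using False w by (simp add: \<delta>_def)
    have sub: "cball w \<delta> \<subseteq> upper_half_plane"
    proof
      fix z assume "z \<in> cball w \<delta>"
      then have "Im (w - z) \<le> \<delta>"
        using abs_Im_le_cmod[of "w - z"] abs_ge_self[of "Im (w - z)"] by (simp add: dist_norm)
      then show "z \<in> upper_half_plane"
        using \<delta> unfolding upper_half_plane_def \<delta>_def by simp
    qed
    have "compact (F ` cball w \<delta>)"
      using holo sub by (intro compact_continuous_image) 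
        (auto intro: continuous_on_subset holomorphic_on_imp_continuous_on)
    then obtain B where B: "\<And>z. z \<in> cball w \<delta> \<Longrightarrow> cmod (F z) \<le> B"
      by (meson bounded_iff compact_imp_bounded imageI)
    show ?thesis
    proof (rule hardy_H2_quadratic_decay[OF holo \<delta>])
      fix z assume z: "Im z > 0"
      have x: "(Re z - Re w)\<^sup>2 \<le> (cmod (z - w))\<^sup>2"
        unfolding dist2 by simp
      show "(cmod (F z))\<^sup>2 * ((Re z - Re w)\<^sup>2 + \<delta>\<^sup>2) \<le> 2 * B\<^sup>2 * \<delta>\<^sup>2 + 2 * C\<^sup>2"
      proof (cases "z \<in> cball w \<delta>")
        case True
        then have "(cmod (z - w))\<^sup>2 \<le> \<delta>\<^sup>2"
          by (intro power_mono) (auto simp: dist_norm norm_minus_commute)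
        moreover have "(cmod (F z))\<^sup>2 \<le> B\<^sup>2"
          using B[OF True] by (intro power_mono) auto
        ultimately have "(cmod (F z))\<^sup>2 * ((Re z - Re w)\<^sup>2 + \<delta>\<^sup>2) \<le> B\<^sup>2 * (\<delta>\<^sup>2 + \<delta>\<^sup>2)"
          using x by (intro mult_mono) auto
        also have "\<dots> \<le> 2 * B\<^sup>2 * \<delta>\<^sup>2 + 2 * C\<^sup>2" by (simp add: algebra_simps)
        finally show ?thesis .
      next
        case False
        then have "\<delta>\<^sup>2 \<le> (cmod (z - w))\<^sup>2"
          using \<delta> by (intro power_mono) (auto simp: dist_norm norm_minus_commute)
        then have "(cmod (F z))\<^sup>2 * ((Re z - Re w)\<^sup>2 + \<delta>\<^sup>2) \<le> (cmod (F z))\<^sup>2 * (2 * (cmod (z - w))\<^sup>2)"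
          using x by (intro mult_left_mono) auto
        also have "\<dots> \<le> 2 * C\<^sup>2" using le2[OF z] by simp
        also have "\<dots> \<le> 2 * B\<^sup>2 * \<delta>\<^sup>2 + 2 * C\<^sup>2" by simp
        finally show ?thesis .
      qed
    qed
  qed
qed

context HB
begin

definition kernel_num :: "complex \<Rightarrow> complex \<Rightarrow> complex" where
  "kernel_num w z = E z * cnj (E w) - sharp E z * E (cnj w)"

text \<open>This is \<open>-2 \<pi> \<i> K\<^sub>w\<close> for the reproducing kernel \<open>K\<^sub>w\<close> of \<open>H(E)\<close>. The numerator vanishes at
  \<open>cnj w\<close>, where its derivative is the analytic value of the quotient.\<close>

definition kernel :: "complex \<Rightarrow> complex \<Rightarrow> complex" where
  "kernel w z = (if z = cnj w then deriv (kernel_num w) (cnj w)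
                 else kernel_num w z / (z - cnj w))"

text \<open>This is \<open>4 \<pi> K\<^sub>w(w)\<close> for nonreal \<open>w\<close>.\<close>

definition diag :: "complex \<Rightarrow> real" where
  "diag w = ((cmod (E w))\<^sup>2 - (cmod (E (cnj w)))\<^sup>2) / Im w"

lemma diag_pos: "Im w > 0 \<Longrightarrow> diag w > 0"
  unfolding diag_def using E_less[of w]
  by (intro divide_pos_pos) (auto intro!: power_strict_mono)

lemma diag_cnj: "diag (cnj w) = diag w"
  by (simp add: diag_def minus_divide_left flip: minus_divide_right)

lemma diag_pos_nonreal: "Im w \<noteq> 0 \<Longrightarrow> diag w > 0"
  using diag_pos[of w] diag_pos[of "cnj w"] by (cases "Im w > 0") (auto simp: diag_cnj)

lemma kernel_num_diag: "Im w \<noteq> 0 \<Longrightarrow> kernel_num w w = of_real (Im w * diag w)"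
  by (simp add: kernel_num_def diag_def sharp_def complex_norm_square mult.commute
       del: of_real_power)

lemma kernel_num_cnj: "cnj (kernel_num (cnj w) (cnj z)) = - kernel_num w z"
  by (simp add: kernel_num_def sharp_def mult.commute)

lemma kernel_num_entire: "entire (kernel_num w)"
  unfolding entire_def kernel_num_def using E_entire entire_sharp[OF E_entire]
  by (intro holomorphic_intros) (auto simp: entire_def)

lemma kernel_entire: "entire (kernel w)"
proof -
  have "kernel_num w (cnj w) = 0"
    by (simp add: kernel_num_def sharp_def)
  then have "kernel w = (\<lambda>z. if z = cnj w then deriv (kernel_num w) (cnj w)
      else (kernel_num w z - kernel_num w (cnj w)) / (z - cnj w))"
    by (auto simp: kernel_def)
  then show ?thesis
    using pole_lemma[of "kernel_num w" UNIV "cnj w"] kernel_num_entire[of w] by (simp add: entire_def)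
qed

lemma kernel_mult_le: "cmod (kernel w z) * cmod (z - cnj w) \<le> cmod (kernel_num w z)"
  by (simp add: kernel_def norm_divide)

lemma quotient_holomorphic:
  "entire f \<Longrightarrow> (\<lambda>z. f z / E z) holomorphic_on upper_half_plane"
  using E_entire E_nonzero by (intro holomorphic_intros)
    (auto simp: entire_def upper_half_plane_def elim: holomorphic_on_subset)

text \<open>In the upper half-plane \<open>\<bar>E\<^sup>#\<bar> \<le> \<bar>E\<bar>\<close>, hence the numerators of \<open>K\<^sub>w\<close> and of \<open>K\<^sub>w\<^sup>#\<close>
  are bounded multiples of \<open>E\<close>. For \<open>K\<^sub>w\<close> the denominator vanishes in the
  lower half-plane, for \<open>K\<^sub>w\<^sup>#\<close> it vanishes at \<open>w\<close> itself.\<close>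

lemma kernel_mem:
  assumes "Im w > 0"
  shows "kernel w \<in> de_branges E"
proof -
  define C where "C = cmod (E w) + cmod (E (cnj w))"
  have num: "cmod (a * b - c * d) \<le> m * (cmod b + cmod d)" if "cmod a \<le> m" "cmod c \<le> m" for a b c d m
  proof -
    have "cmod (a * b - c * d) \<le> cmod a * cmod b + cmod c * cmod d"
      using norm_triangle_ineq4[of "a * b" "c * d"] by (simp add: norm_mult)
    also have "\<dots> \<le> m * cmod b + m * cmod d"
      using that by (intro add_mono mult_right_mono) auto
    finally show ?thesis by (simp add: algebra_simps)
  qed
  have quot: "cmod (f z / E z) * r \<le> C" 
    if "cmod (f z) * r \<le> cmod (E z) * C" "Im z > 0" for f z r
  proof -
    have "cmod (f z / E z) * r = cmod (f z) * r / cmod (E z)"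
      by (simp add: norm_divide)
    also have "\<dots> \<le> cmod (E z) * C / cmod (E z)"
      by (intro divide_right_mono that) auto
    also have "\<dots> = C" using E_nonzero[OF that(2)] by simp
    finally show ?thesis .
  qed
  have "(\<lambda>z. kernel w z / E z) \<in> hardy_H2"
  proof (rule hardy_H2_decay[where w = "cnj w"])
    show "cmod (kernel w z / E z) * cmod (z - cnj w) \<le> C" if "Im z > 0" for z
    proof (rule quot[OF _ that])
      have "cmod (kernel_num w z) \<le> cmod (E z) * C"
        unfolding kernel_num_def C_def using E_less[OF that] num[of "E z" "cmod (E z)" "sharp E z" "cnj (E w)"]
        by (simp add: sharp_def)
      with kernel_mult_le[of w z] show "cmod (kernel w z) * cmod (z - cnj w) \<le> cmod (E z) * C" 
        by linarith
    qed
  qed (use assms in \<open>auto intro: quotient_holomorphic kernel_entire\<close>)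
  moreover have "(\<lambda>z. sharp (kernel w) z / E z) \<in> hardy_H2"
  proof (rule hardy_H2_decay[where w = w])
    show "cmod (sharp (kernel w) z / E z) * cmod (z - w) \<le> C" if "Im z > 0" for z
    proof (rule quot[OF _ that])
      have "cmod (kernel_num w (cnj z)) \<le> cmod (E z) * C"
        unfolding kernel_num_def C_def using E_less[OF that] num[of "E (cnj z)" "cmod (E z)" "sharp E (cnj z)" "cnj (E w)"]
        by (simp add: sharp_def)
      moreover have "cmod (cnj z - cnj w) = cmod (z - w)"
        by (metis complex_cnj_diff complex_mod_cnj)
      ultimately show "cmod (sharp (kernel w) z) * cmod (z - w) \<le> cmod (E z) * C" 
        using kernel_mult_le[of w "cnj z"] by (simp add: sharp_def)
    qed
  qed (use assms in \<open>auto intro: quotient_holomorphic entire_sharp kernel_entire\<close>)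
  ultimately show ?thesis
    by (simp add: de_branges_def kernel_entire)
qed

text \<open>On the real line \<open>\<bar>E\<bar>\<^sup>2 = E E\<^sup>#\<close>, and this splits the inner product into Cauchy integrals of
  \<open>f / E\<close> and \<open>f / E\<^sup>#\<close>. The first gives \<open>f w\<close>. The second vanishes, because its conjugate is the Cauchy
  integral of \<open>f\<^sup># / E\<close> at the point \<open>cnj w\<close> of the lower half-plane.\<close>

lemma reproducing:
  assumes f: "f \<in> de_branges E" and w: "Im w > 0"
  shows "db_inner E f (kernel w) = 2 * pi * \<i> * f w"
proof -
  note F = de_brangesD[OF f]
  let ?A = "\<lambda>t. f (of_real t) / E (of_real t) / (of_real t - w)"
  let ?B = "\<lambda>t. cnj (sharp f (of_real t) / E (of_real t) / (of_real t - cnj w))"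
  have ne: "Im w \<noteq> 0" "Im (cnj w) \<noteq> 0" "Im (cnj w) < 0" using w by auto
  have A: "integrable lborel ?A" "(LINT t|lborel. ?A t) = 2 * pi * \<i> * (f w / E w)"
    by (fact cauchy_transform(1)[OF F(1,2) ne(1)], fact cauchy_transform(2)[OF F(1,2) ne(1) w])
  have B: "integrable lborel ?B"
    by (rule integrable_cnj) (fact cauchy_transform(1)[OF entire_sharp[OF F(1)] F(3) ne(2)])
  have B0: "(LINT t|lborel. ?B t) = 0"
    using cauchy_transform(3)[OF entire_sharp[OF F(1)] F(3) ne(2,3)]
    by (simp only: Bochner_Integration.integral_cnj complex_cnj_zero)
  have eq: "AE t in lborel. f (of_real t) * cnj (kernel w (of_real t)) / of_real ((cmod (E (of_real t)))\<^sup>2)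
      = E w * ?A t - cnj (E (cnj w)) * ?B t"
    using E_real_nonzero_AE
  proof eventually_elim
    case (elim t)
    have ne: "of_real t - w \<noteq> 0" "of_real t \<noteq> cnj w"
      using w by (auto simp: complex_eq_iff)
    have "cnj (kernel w (of_real t))
        = (cnj (E (of_real t)) * E w - E (of_real t) * cnj (E (cnj w))) / (of_real t - w)"
      using ne by (simp add: kernel_def kernel_num_def)
    moreover have "?B t = f (of_real t) / cnj (E (of_real t)) / (of_real t - w)"
      by simp
    moreover have "x * ((e' * a - e * b) / r) / (e * e') = a * (x / e / r) - b * (x / e' / r)"
      if "e \<noteq> 0" "e' \<noteq> 0" "r \<noteq> 0" for x e e' a b r :: complex
      using that by (simp add: field_simps)
    ultimately show ?case
      using elim ne by (simp only: complex_norm_square complex_cnj_zero_iff not_False_eq_True)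
  qed
  have "db_inner E f (kernel w) = (LINT t|lborel. E w * ?A t - cnj (E (cnj w)) * ?B t)"
    unfolding db_inner_def
  proof (rule integral_cong_AE[OF _ _ eq])
    show "(\<lambda>t. f (of_real t) * cnj (kernel w (of_real t)) / of_real ((cmod (E (of_real t)))\<^sup>2))
        \<in> borel_measurable lborel"
      using entire_measurable_real[OF F(1)] entire_measurable_real[OF E_entire]
        entire_measurable_real[OF entire_sharp[OF kernel_entire[of w]]] by simp
    show "(\<lambda>t. E w * ?A t - cnj (E (cnj w)) * ?B t) \<in> borel_measurable lborel"
      using A(1) B by (intro borel_measurable_integrable Bochner_Integration.integrable_diff integrable_mult_right)
  qed
  also have "\<dots> = E w * (LINT t|lborel. ?A t) - cnj (E (cnj w)) * (LINT t|lborel. ?B t)"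
    using A(1) B by (simp only: Bochner_Integration.integral_diff integrable_mult_right integral_mult_right_zero)
  also have "\<dots> = 2 * pi * \<i> * f w"
    unfolding A(2) B0 using E_nonzero[OF w] by simp
  finally show ?thesis .
qed

lemma db_inner_self:
  "db_inner E f f = of_real (LINT t|lborel. (cmod (f (of_real t) / E (of_real t)))\<^sup>2)"
  unfolding db_inner_def integral_complex_of_real[symmetric]
  by (intro Bochner_Integration.integral_cong)
     (auto simp: norm_divide power_divide complex_norm_square simp del: of_real_power)

lemma db_norm_square: "(db_norm E f)\<^sup>2 = (LINT t|lborel. (cmod (f (of_real t) / E (of_real t)))\<^sup>2)"
  by (simp add: db_norm_def db_inner_self)

lemma db_norm_nonneg: "db_norm E f \<ge> 0"
  by (simp add: db_norm_def db_inner_self)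

lemma db_norm_sharp: "db_norm E (sharp f) = db_norm E f"
  by (simp add: db_norm_def db_inner_self norm_divide)

lemma db_norm_kernel:
  assumes "Im w > 0" shows "(db_norm E (kernel w))\<^sup>2 = pi * diag w"
proof -
  have "w \<noteq> cnj w" using assms by (auto simp: complex_eq_iff)
  have "db_inner E (kernel w) (kernel w) = 2 * pi * \<i> * (of_real (Im w * diag w) / (w - cnj w))"
    using reproducing[OF kernel_mem[OF assms] assms] kernel_num_diag[of w] assms \<open>w \<noteq> cnj w\<close>
    by (simp add: kernel_def)
  also have "w - cnj w = 2 * \<i> * of_real (Im w)"
    by (simp add: complex_eq_iff)
  finally have "db_inner E (kernel w) (kernel w) = of_real (pi * diag w)"
    using assms by (simp add: field_simps)
  then show ?thesis
    unfolding db_norm_square db_inner_self of_real_eq_iff .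
qed

lemma cauchy_schwarz:
  assumes "f \<in> de_branges E" "g \<in> de_branges E"
  shows "cmod (db_inner E f g) \<le> db_norm E f * db_norm E g"
proof -
  let ?q = "\<lambda>f t. f (of_real t) / E (of_real t)"
  have meas: "(\<lambda>t. cmod (?q f t)) \<in> borel_measurable lborel" if "f \<in> de_branges E" for f
    using entire_measurable_real[OF de_brangesD(1)[OF that]] entire_measurable_real[OF E_entire] by simp
  have sq: "(\<integral>\<^sup>+t. (ennreal (cmod (?q f t)))\<^sup>2 \<partial>lborel) = ennreal ((db_norm E f)\<^sup>2)" if "f \<in> de_branges E" for f
    using nn_integral_eq_integral[OF square_integrable[OF that]]
    by (simp add: db_norm_square ennreal_power)
  have "ennreal (cmod (db_inner E f g)) \<le> (\<integral>\<^sup>+t. ennreal (cmod (?q f t)) * ennreal (cmod (?q g t)) \<partial>lborel)"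
  proof (cases "integrable lborel (\<lambda>t. f (of_real t) * cnj (g (of_real t)) / of_real ((cmod (E (of_real t)))\<^sup>2))")
    case True
    from integral_norm_bound_ennreal[OF this] show ?thesis
      by (simp add: db_inner_def norm_mult norm_divide power2_eq_square ennreal_mult'[symmetric])
  next
    case False
    then show ?thesis by (simp add: db_inner_def not_integrable_integral_eq)
  qed
  then have "(ennreal (cmod (db_inner E f g)))\<^sup>2
      \<le> (\<integral>\<^sup>+t. ennreal (cmod (?q f t)) * ennreal (cmod (?q g t)) \<partial>lborel)\<^sup>2"
    by (rule power_mono) simp
  also have "\<dots> \<le> (\<integral>\<^sup>+t. (ennreal (cmod (?q f t)))\<^sup>2 \<partial>lborel) * (\<integral>\<^sup>+t. (ennreal (cmod (?q g t)))\<^sup>2 \<partial>lborel)"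
    using meas assms by (intro Cauchy_Schwarz_nn_integral) auto
  also have "\<dots> = ennreal ((db_norm E f * db_norm E g)\<^sup>2)"
    using assms by (simp add: sq ennreal_mult' power_mult_distrib)
  finally have "(cmod (db_inner E f g))\<^sup>2 \<le> (db_norm E f * db_norm E g)\<^sup>2"
    by (simp add: ennreal_power)
  then show ?thesis
    by (rule power2_le_imp_le) (simp add: db_norm_nonneg)
qed

lemma evaluation_bound:
  assumes "f \<in> de_branges E" "Im z > 0"
  shows "4 * pi * (cmod (f z))\<^sup>2 \<le> (db_norm E f)\<^sup>2 * diag z"
proof -
  have "2 * pi * cmod (f z) \<le> db_norm E f * db_norm E (kernel z)"
    using cauchy_schwarz[OF assms(1) kernel_mem[OF assms(2)]] reproducing[OF assms]
    by (simp add: norm_mult)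
  from power_mono[OF this, of 2] have "pi * (4 * pi * (cmod (f z))\<^sup>2) \<le> pi * ((db_norm E f)\<^sup>2 * diag z)"
    using db_norm_kernel[OF assms(2)] by (simp add: power_mult_distrib power2_eq_square mult_ac)
  then show ?thesis by simp
qed

text \<open>The kernel at a point of the lower half-plane is, up to sign, the conjugate \<open>K\<^sup>#\<close> of the kernel at the
  reflected point, and \<open>f \<mapsto> f\<^sup>#\<close> preserves \<open>H(E)\<close> and its norm. So nonreal points of both half-planes
  provide test functions.\<close>

lemma test_function:
  assumes "Im w \<noteq> 0"
  obtains f where "f \<in> de_branges E" "(db_norm E f)\<^sup>2 = pi * diag w"
    "\<And>c. c \<noteq> cnj w \<Longrightarrow> cmod (f c) = cmod (kernel_num w c) / cmod (c - cnj w)"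
proof (cases "Im w > 0")
  case True
  then show thesis
    by (intro that[of "kernel w"]) (auto simp: kernel_mem db_norm_kernel kernel_def norm_divide)
next
  case False
  then have w: "Im (cnj w) > 0" using assms by simp
  have "cmod (sharp (kernel (cnj w)) c) = cmod (kernel_num w c) / cmod (c - cnj w)" if "c \<noteq> cnj w" for c
  proof -
    have "cnj c \<noteq> w" using that by auto
    moreover have "cmod (cnj c - w) = cmod (c - cnj w)"
      by (metis complex_cnj_cnj complex_cnj_diff complex_mod_cnj)
    moreover have "cmod (kernel_num (cnj w) (cnj c)) = cmod (kernel_num w c)"
      by (metis complex_mod_cnj kernel_num_cnj norm_minus_cancel)
    ultimately show ?thesis
      by (simp add: sharp_def kernel_def norm_divide)
  qed
  with w show thesis
    by (intro that[of "sharp (kernel (cnj w))"])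
       (auto simp: sharp_mem kernel_mem db_norm_sharp db_norm_kernel diag_cnj simp del: complex_cnj)
qed

end

section \<open>The kernel near the real line\<close>

text \<open>Continuity of the derivative gives differentiability uniformly in both points, by the mean value
  inequality for \<open>f z - deriv f c * z\<close>.\<close>

lemma strict_complex_derivative:
  assumes f: "entire f" and "\<epsilon> > 0"
  obtains \<delta> where "\<delta> > 0"
    "\<And>a b. a \<in> ball c \<delta> \<Longrightarrow> b \<in> ball c \<delta> \<Longrightarrow> cmod (f a - f b - deriv f c * (a - b)) \<le> \<epsilon> * cmod (a - b)"
proof -
  have "deriv f holomorphic_on UNIV"
    using f unfolding entire_def by (intro holomorphic_deriv) auto
  then have "isCont (deriv f) c"
    using holomorphic_on_imp_continuous_on continuous_on_eq_continuous_at by blast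
  then obtain \<delta> where \<delta>: "\<delta> > 0" "\<And>z. dist z c < \<delta> \<Longrightarrow> dist (deriv f z) (deriv f c) < \<epsilon>"
    using \<open>\<epsilon> > 0\<close> unfolding continuous_at by (metis continuous_at_eps_delta continuous_at)
  show thesis
  proof (rule that[OF \<delta>(1)])
    fix a b assume ab: "a \<in> ball c \<delta>" "b \<in> ball c \<delta>"
    have "cmod ((f a - deriv f c * a) - (f b - deriv f c * b)) \<le> \<epsilon> * cmod (a - b)"
    proof (rule field_differentiable_bound[OF convex_ball _ _ ab])
      fix z assume "z \<in> ball c \<delta>"
      then show "cmod (deriv f z - deriv f c) \<le> \<epsilon>"
        using \<delta>(2)[of z] by (simp add: dist_norm norm_minus_commute less_imp_le)
      have "(f has_field_derivative deriv f z) (at z)"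
        using f unfolding entire_def by (intro holomorphic_derivI[of f UNIV]) auto
      then show "((\<lambda>z. f z - deriv f c * z) has_field_derivative deriv f z - deriv f c) (at z within ball c \<delta>)"
        by (auto intro!: derivative_eq_intros intro: has_field_derivative_at_within)
    qed
    then show "cmod (f a - f b - deriv f c * (a - b)) \<le> \<epsilon> * cmod (a - b)"
      by (simp add: algebra_simps)
  qed
qed

lemma difference_quotient_tendsto:
  assumes f: "entire f" and a: "(a \<longlongrightarrow> c) F" and b: "(b \<longlongrightarrow> c) F"
    and ne: "\<forall>\<^sub>F w in F. a w \<noteq> b w"
  shows "((\<lambda>w. (f (a w) - f (b w)) / (a w - b w)) \<longlongrightarrow> deriv f c) F"
proof (rule tendstoI)
  fix e :: real assume "e > 0"
  then have "e / 2 > 0" by simp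
  from strict_complex_derivative[OF f this] obtain \<delta> where \<delta>: "\<delta> > 0"
    "\<And>a b. a \<in> ball c \<delta> \<Longrightarrow> b \<in> ball c \<delta> \<Longrightarrow> cmod (f a - f b - deriv f c * (a - b)) \<le> e / 2 * cmod (a - b)"
    by blast
  from tendstoD[OF a \<delta>(1)] tendstoD[OF b \<delta>(1)] ne
  show "\<forall>\<^sub>F w in F. dist ((f (a w) - f (b w)) / (a w - b w)) (deriv f c) < e"
  proof eventually_elim
    case (elim w)
    then have "cmod (f (a w) - f (b w) - deriv f c * (a w - b w)) \<le> e / 2 * cmod (a w - b w)"
      by (intro \<delta>) (auto simp: dist_commute)
    moreover have "(f (a w) - f (b w)) / (a w - b w) - deriv f c
        = (f (a w) - f (b w) - deriv f c * (a w - b w)) / (a w - b w)"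
      using elim by (simp add: divide_simps)
    ultimately have "cmod ((f (a w) - f (b w)) / (a w - b w) - deriv f c) \<le> e / 2"
      using elim by (simp add: norm_divide divide_le_eq)
    then show ?case using \<open>e > 0\<close> by (simp add: dist_norm)
  qed
qed

lemma nonreal_filter_nontrivial:
  assumes "Im c = 0" shows "at c within {w. Im w \<noteq> 0} \<noteq> bot"
proof -
  have "c islimpt {w. Im w \<noteq> 0}"
    unfolding islimpt_approachable
  proof (intro allI impI)
    fix e :: real assume "e > 0"
    then show "\<exists>w\<in>{w. Im w \<noteq> 0}. w \<noteq> c \<and> dist w c < e"
      using assms by (intro bexI[of _ "c + \<i> * of_real (e / 2)"]) (auto simp: dist_norm norm_mult)
  qed
  then show ?thesis by (simp add: trivial_limit_within)
qed

context HB
begin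

lemma quotient_expr_eq:
  assumes "Im z > 0" "Im w \<noteq> 0" "E w \<noteq> 0"
  shows "quotient_expr E z w = diag w / diag z"
proof -
  have *: "(cmod (E v))\<^sup>2 * (1 - (cmod (chi E v))\<^sup>2) = Im v * diag v" if "Im v \<noteq> 0" "E v \<noteq> 0" for v
  proof -
    have "(cmod (E v))\<^sup>2 * (1 - (cmod (chi E v))\<^sup>2) = (cmod (E v))\<^sup>2 - (cmod (E (cnj v)))\<^sup>2"
      using that by (simp add: chi_def sharp_def norm_divide power_divide right_diff_distrib)
    then show ?thesis using that by (simp add: diag_def)
  qed
  have ne: "E z \<noteq> 0" "diag z \<noteq> 0" using E_nonzero diag_pos[of z] assms(1) by auto
  have "quotient_expr E z w = Im z / Im w *
      (((cmod (E w))\<^sup>2 * (1 - (cmod (chi E w))\<^sup>2)) / ((cmod (E z))\<^sup>2 * (1 - (cmod (chi E z))\<^sup>2)))"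
    by (simp add: quotient_expr_def norm_divide power_divide)
  also have "\<dots> = Im z / Im w * ((Im w * diag w) / (Im z * diag z))"
    using assms ne by (simp only: * less_imp_neq[symmetric] not_False_eq_True)
  also have "\<dots> = diag w / diag z"
    using assms ne by simp
  finally show ?thesis .
qed

text \<open>The value \<open>4 \<pi> K\<^sub>c(c)\<close> for real \<open>c\<close>, where the quotient defining it for nonreal points reads 0/0.\<close>

definition real_diag :: "complex \<Rightarrow> real" where
  "real_diag c = 4 * Re (\<i> * deriv E c * cnj (E c))"

text \<open>The polarisation \<open>\<bar>a\<bar>\<^sup>2 - \<bar>b\<bar>\<^sup>2 = Re ((a - b) cnj (a + b))\<close> with \<open>a = E w\<close> and \<open>b = E (cnj w)\<close>
  reduces the limit to that of a difference quotient of \<open>E\<close>.\<close>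

lemma diag_tendsto:
  assumes "Im c = 0"
  shows "(diag \<longlongrightarrow> real_diag c) (at c within {w. Im w \<noteq> 0})" (is "(_ \<longlongrightarrow> _) ?F")
proof -
  have c: "cnj c = c" using assms by (simp add: complex_eq_iff)
  have id: "((\<lambda>w. w) \<longlongrightarrow> c) ?F" by (rule tendsto_ident_at)
  have cnj: "(cnj \<longlongrightarrow> c) ?F" using tendsto_cnj[OF id] c by simp
  have nonreal: "\<forall>\<^sub>F w in ?F. Im w \<noteq> 0"
    by (simp add: eventually_at_filter)
  then have ne: "\<forall>\<^sub>F w in ?F. w \<noteq> cnj w"
    by eventually_elim (auto simp: complex_eq_iff)
  have E: "((\<lambda>w. E (a w)) \<longlongrightarrow> E c) ?F" if "(a \<longlongrightarrow> c) ?F" for a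
    by (rule continuous_on_tendsto_compose[OF entire_continuous[OF E_entire, of UNIV] that]) auto
  have "((\<lambda>w. Re (2 * \<i> * ((E w - E (cnj w)) / (w - cnj w)) * cnj (E w + E (cnj w))))
      \<longlongrightarrow> Re (2 * \<i> * deriv E c * cnj (E c + E c))) ?F"
    by (intro tendsto_intros difference_quotient_tendsto E_entire id cnj ne E)
  moreover have "\<forall>\<^sub>F w in ?F. Re (2 * \<i> * ((E w - E (cnj w)) / (w - cnj w)) * cnj (E w + E (cnj w))) = diag w"
    using nonreal
  proof eventually_elim
    case (elim w)
    have "w - cnj w = 2 * \<i> * of_real (Im w)"
      by (simp add: complex_eq_iff)
    then have "2 * \<i> * ((E w - E (cnj w)) / (w - cnj w)) * cnj (E w + E (cnj w))
        = ((E w - E (cnj w)) * cnj (E w + E (cnj w))) / of_real (Im w)"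
      using elim by simp
    moreover have "Re ((E w - E (cnj w)) * cnj (E w + E (cnj w))) = (cmod (E w))\<^sup>2 - (cmod (E (cnj w)))\<^sup>2"
      by (simp add: cmod_power2) (simp add: algebra_simps power2_eq_square)
    ultimately show ?case by (simp only: Re_divide_of_real diag_def)
  qed
  ultimately have "(diag \<longlongrightarrow> Re (2 * \<i> * deriv E c * cnj (E c + E c))) ?F"
    by (rule Lim_transform_eventually)
  then show ?thesis by (simp add: real_diag_def algebra_simps)
qed

text \<open>The numerator is a combination of the increments of \<open>E\<close> from \<open>c\<close> to \<open>cnj w\<close> and from \<open>c\<close> to \<open>w\<close>,
  because \<open>E\<^sup># c = cnj (E c)\<close>. The limit is half of the diagonal value, like
  \<open>\<bar>kernel w w\<bar> = diag w / 2\<close> at nonreal points.\<close>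

lemma kernel_num_tendsto:
  assumes "Im c = 0"
  shows "((\<lambda>w. cmod (kernel_num w c) / cmod (c - cnj w)) \<longlongrightarrow> \<bar>real_diag c\<bar> / 2)
           (at c within {w. Im w \<noteq> 0})" (is "(_ \<longlongrightarrow> _) ?F")
proof -
  have c: "cnj c = c" using assms by (simp add: complex_eq_iff)
  have id: "((\<lambda>w. w) \<longlongrightarrow> c) ?F" by (rule tendsto_ident_at)
  have cnj: "(cnj \<longlongrightarrow> c) ?F" using tendsto_cnj[OF id] c by simp
  have nonreal: "\<forall>\<^sub>F w in ?F. Im w \<noteq> 0"
    by (simp add: eventually_at_filter)
  then have ne: "\<forall>\<^sub>F w in ?F. w \<noteq> c" "\<forall>\<^sub>F w in ?F. cnj w \<noteq> c"
    by (eventually_elim, use assms in force)+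
  have "((\<lambda>w. cmod (cnj (E c) * ((E (cnj w) - E c) / (cnj w - c)) - E c * cnj ((E w - E c) / (w - c))))
      \<longlongrightarrow> cmod (cnj (E c) * deriv E c - E c * cnj (deriv E c))) ?F"
    by (intro tendsto_intros difference_quotient_tendsto E_entire id cnj ne)
  moreover have "\<forall>\<^sub>F w in ?F. cmod (cnj (E c) * ((E (cnj w) - E c) / (cnj w - c)) - E c * cnj ((E w - E c) / (w - c)))
      = cmod (kernel_num w c) / cmod (c - cnj w)"
    using nonreal
  proof eventually_elim
    case (elim w)
    have "cnj w \<noteq> c" using elim assms by force
    have "cnj ((E w - E c) / (w - c)) = (cnj (E w) - cnj (E c)) / (cnj w - c)"
      by (simp add: c)
    then have "cnj (E c) * ((E (cnj w) - E c) / (cnj w - c)) - E c * cnj ((E w - E c) / (w - c))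
       = kernel_num w c / (c - cnj w)"
      using \<open>cnj w \<noteq> c\<close> by (simp add: kernel_num_def sharp_def c divide_simps) (simp add: algebra_simps)
    then show ?case by (simp add: norm_divide)
  qed
  ultimately have "((\<lambda>w. cmod (kernel_num w c) / cmod (c - cnj w))
      \<longlongrightarrow> cmod (cnj (E c) * deriv E c - E c * cnj (deriv E c))) ?F"
    by (rule Lim_transform_eventually)
  moreover have "cmod (cnj (E c) * deriv E c - E c * cnj (deriv E c)) = \<bar>real_diag c\<bar> / 2"
  proof -
    have "cnj (E c) * deriv E c - E c * cnj (deriv E c) = - \<i> * of_real (real_diag c / 2)"
      by (simp add: real_diag_def complex_eq_iff algebra_simps)
    then show ?thesis by (simp add: norm_mult)
  qed
  ultimately show ?thesis by simp
qed

section \<open>Testing the composition operator on kernels\<close>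

text \<open>Testing on the kernels \<open>K\<^sub>w\<close> gives \<open>main\<close>, for all nonreal \<open>w\<close>. If \<open>c = \<phi> z\<close> is not real, \<open>w = c\<close> is
  admissible; if it is real, \<open>w\<close> tends to \<open>c\<close>. In both cases this yields \<open>l\<^sup>2 \<le> C\<^sup>2 l diag z\<close>
  for the value \<open>l\<close> of the diagonal at \<open>c\<close>. The sign condition \<open>l \<ge> 0\<close>, unlike \<open>l > 0\<close>, passes to the limit;
  for \<open>l = 0\<close> the bound on \<open>l / diag z\<close> is trivial.\<close>

lemma comp_quotient_bound:
  assumes C: "\<And>f. f \<in> de_branges E \<Longrightarrow> f \<circ> \<phi> \<in> de_branges E"
             "\<And>f. f \<in> de_branges E \<Longrightarrow> db_norm E (f \<circ> \<phi>) \<le> C * db_norm E f"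
    and z: "z \<in> Lam E \<phi>"
  shows "comp_quotient E \<phi> z \<le> C\<^sup>2"
proof -
  define c where "c = \<phi> z"
  have Im: "Im z > 0" and nz: "E c \<noteq> 0"
    using z by (auto simp: Lam_def upper_half_plane_def c_def)
  have dz: "diag z > 0" using diag_pos[OF Im] .
  have main: "4 * (cmod (kernel_num w c) / cmod (c - cnj w))\<^sup>2 \<le> C\<^sup>2 * diag w * diag z"
    if w: "Im w \<noteq> 0" "c \<noteq> cnj w" for w
  proof -
    obtain f where f: "f \<in> de_branges E" "(db_norm E f)\<^sup>2 = pi * diag w"
      "cmod (f c) = cmod (kernel_num w c) / cmod (c - cnj w)"
      using test_function[OF w(1)] w(2) by metis
    have "4 * pi * (cmod ((f \<circ> \<phi>) z))\<^sup>2 \<le> (db_norm E (f \<circ> \<phi>))\<^sup>2 * diag z"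
      by (rule evaluation_bound[OF C(1)[OF f(1)] Im])
    also have "\<dots> \<le> (C * db_norm E f)\<^sup>2 * diag z"
      using C(2)[OF f(1)] dz by (intro mult_right_mono power_mono) (auto simp: db_norm_nonneg)
    finally have "pi * (4 * (cmod (f c))\<^sup>2) \<le> pi * (C\<^sup>2 * diag w * diag z)"
      by (simp add: power_mult_distrib f(2) c_def mult_ac)
    then show ?thesis by (simp add: f(3))
  qed
  have cancel: "l / diag z \<le> C\<^sup>2" if "l * l \<le> C\<^sup>2 * l * diag z" "l \<ge> 0" for l
  proof (cases "l = 0")
    case False
    with that have "l \<le> C\<^sup>2 * diag z"
      by (metis mult.assoc mult.commute mult_le_cancel_left_pos order_le_less)
    then show ?thesis using dz by (simp add: divide_le_eq)
  qed simp
  show ?thesis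
  proof (cases "Im c = 0")
    case False
    then have "c \<noteq> cnj c" by (auto simp: complex_eq_iff)
    have "c - cnj c = 2 * \<i> * of_real (Im c)"
      by (simp add: complex_eq_iff)
    then have half: "cmod (kernel_num c c) / cmod (c - cnj c) = \<bar>diag c\<bar> / 2"
      using False by (simp add: kernel_num_diag norm_mult abs_mult)
    have "diag c * diag c \<le> C\<^sup>2 * diag c * diag z"
      using main[OF False \<open>c \<noteq> cnj c\<close>] unfolding half by (simp add: power2_eq_square)
    then have "diag c / diag z \<le> C\<^sup>2"
      using diag_pos_nonreal[OF False] by (intro cancel) auto
    then show ?thesis
      using False by (simp add: comp_quotient_def quotient_expr_eq[OF Im False nz] flip: c_def)
  next
    case True
    let ?F = "at c within {w. Im w \<noteq> 0}"
    note nontriv = nonreal_filter_nontrivial[OF True]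
    have nonreal: "\<forall>\<^sub>F w in ?F. Im w \<noteq> 0"
      by (simp add: eventually_at_filter)
    have "(E \<longlongrightarrow> E c) ?F"
      using entire_continuous[OF E_entire, of UNIV] 
      by (metis continuous_on_eq_continuous_at UNIV_I open_UNIV continuous_at_imp_continuous_at_within continuous_within)
    then have "\<forall>\<^sub>F w in ?F. E w \<noteq> 0"
      using nz by (rule tendsto_imp_eventually_ne)
    with nonreal have "\<forall>\<^sub>F w in ?F. diag w / diag z = quotient_expr E z w"
      by eventually_elim (simp add: quotient_expr_eq Im)
    moreover have "((\<lambda>w. diag w / diag z) \<longlongrightarrow> real_diag c / diag z) ?F"
      using dz by (intro tendsto_intros diag_tendsto True) auto
    ultimately have "(quotient_expr E z \<longlongrightarrow> real_diag c / diag z) ?F"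
      using Lim_transform_eventually by blast
    then have eq: "comp_quotient E \<phi> z = real_diag c / diag z"
      using True nontriv by (simp add: comp_quotient_def tendsto_Lim flip: c_def)
    have "4 * (\<bar>real_diag c\<bar> / 2)\<^sup>2 \<le> C\<^sup>2 * real_diag c * diag z"
    proof (rule tendsto_le[OF nontriv])
      show "((\<lambda>w. C\<^sup>2 * diag w * diag z) \<longlongrightarrow> C\<^sup>2 * real_diag c * diag z) ?F"
        by (intro tendsto_intros diag_tendsto True)
      show "((\<lambda>w. 4 * (cmod (kernel_num w c) / cmod (c - cnj w))\<^sup>2) \<longlongrightarrow> 4 * (\<bar>real_diag c\<bar> / 2)\<^sup>2) ?F"
        by (intro tendsto_intros kernel_num_tendsto True)
      show "\<forall>\<^sub>F w in ?F. 4 * (cmod (kernel_num w c) / cmod (c - cnj w))\<^sup>2 \<le> C\<^sup>2 * diag w * diag z"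
        using nonreal
      proof eventually_elim
        case (elim w)
        then have "c \<noteq> cnj w" using True by force
        then show ?case by (rule main[OF elim])
      qed
    qed
    moreover have "real_diag c \<ge> 0"
    proof (rule tendsto_lowerbound[OF diag_tendsto[OF True] _ nontriv])
      show "\<forall>\<^sub>F w in ?F. 0 \<le> diag w"
        using nonreal by eventually_elim (simp add: diag_pos_nonreal less_imp_le)
    qed
    ultimately show ?thesis
      unfolding eq by (intro cancel) (auto simp: power2_eq_square)
  qed
qed

end

theorem theorem4p2:
  fixes \<phi> E :: "complex \<Rightarrow> complex"
  assumes "entire \<phi>" and "hermite_biehler E"
  shows "(bounded_operator_on E (comp_op \<phi>) \<longrightarrow>
            (SUP z\<in>Lam E \<phi>. ereal (comp_quotient E \<phi> z)) < \<infinity>) \<and>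
         (\<phi> ` upper_half_plane \<subseteq> upper_half_plane \<longrightarrow> Lam E \<phi> = upper_half_plane)"
proof (intro conjI impI)
  interpret HB E by unfold_locales fact
  assume bounded: "bounded_operator_on E (comp_op \<phi>)"
  then have "\<exists>C. \<forall>f\<in>de_branges E. db_norm E (f \<circ> \<phi>) \<le> C * db_norm E f"
    by (simp add: bounded_operator_on_def comp_op_def)
  then obtain C where C: "\<forall>f\<in>de_branges E. db_norm E (f \<circ> \<phi>) \<le> C * db_norm E f" ..
  have "comp_quotient E \<phi> z \<le> C\<^sup>2" if "z \<in> Lam E \<phi>" for z
    using bounded C that by (intro comp_quotient_bound) (auto simp: bounded_operator_on_def comp_op_def)
  then have "(SUP z\<in>Lam E \<phi>. ereal (comp_quotient E \<phi> z)) \<le> ereal (C\<^sup>2)"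
    by (intro SUP_least) simp
  also have "\<dots> < \<infinity>" by simp
  finally show "(SUP z\<in>Lam E \<phi>. ereal (comp_quotient E \<phi> z)) < \<infinity>" .
next
  interpret HB E by unfold_locales fact
  assume "\<phi> ` upper_half_plane \<subseteq> upper_half_plane"
  then show "Lam E \<phi> = upper_half_plane"
    using E_nonzero by (auto simp: Lam_def upper_half_plane_def)
qed

end
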